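(* Let $t_1,t_2\in\mathbb{R}$ and $s_1,s_2>0$ with $(t_1,s_1)\ne(t_2,s_2)$, let $\mathbf{W}_\Phi=[W_\Phi(t_1,s_1)\ W_\Phi(t_2,s_2)]^\top$, and assume that $\Gamma=\mathbb{E}[\mathbf{W}_\Phi\mathbf{W}_\Phi^*]$ is invertible. Then the random variables $|W_\Phi(t_1,s_1)|$ and $\Theta_\Phi(t_2,s_2)$ are independent.
   Context: The function $\psi:\mathbb{R}\to\mathbb{C}$ belongs to $L^1(\mathbb{R})\cap L^2(\mathbb{R})$, with Fourier transform $\widehat\psi(\omega)=\int_{\mathbb{R}}e^{-it\omega}\psi(t)\,dt$. It is an analytic mother wavelet: $\widehat\psi(\omega)=0$ for $\omega\le0$; moreover $|\widehat\psi|$ is unimodal with a unique maximum point in $(0,\infty)$. The noise $\Phi=\{\Phi(t)\}_{t\in\mathbb{R}}$ is a real-valued stationary Gaussian process with constant mean and covariance function $C_\Phi(t_1-t_2)=\mathrm{Cov}(\Phi(t_1),\Phi(t_2))$, which has the spectral representation $C_\Phi(t)=\int_{\mathbb{R}}e^{i\lambda t}F(d\lambda)$ with $F$ a nonnegative measure, $F(\mathbb{R})=C_\Phi(0)$. The analytic wavelet transform of $\Phi$ is $W_\Phi(t,s)=\int_{\mathbb{R}}\Phi(\tau)\frac{1}{\sqrt s}\overline{\psi\left(\frac{\tau-t}{s}\right)}d\tau$, $t\in\mathbb{R}$, $s>0$; it has mean zero because $\widehat\psi(0)=0$. The phase $\Theta_\Phi(t,s)\in[0,2\pi)$ is defined by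 $W_\Phi(t,s)=|W_\Phi(t,s)|e^{i\Theta_\Phi(t,s)}$; $*$ is the conjugate transpose. *)

theory Defs
  imports "HOL-Probability.Probability"
begin

subsection \<open>Wavelets\<close>

definition fourier :: "(real \<Rightarrow> complex) \<Rightarrow> real \<Rightarrow> complex" where
  "fourier \<psi> \<omega> = (CLINT t|lborel. exp (- (\<i> * of_real (t * \<omega>))) * \<psi> t)"

text \<open>Weakly increasing up to the peak and weakly decreasing after it; the maximum itself is
  attained at one point only.\<close>

definition unimodal_with_peak :: "(real \<Rightarrow> real) \<Rightarrow> real \<Rightarrow> bool" where
  "unimodal_with_peak f p \<longleftrightarrow>
     mono_on {..p} f \<and> antimono_on {p..} f \<and> (\<forall>x. x \<noteq> p \<longrightarrow> f x < f p)"

definition analytic_mother_wavelet :: "(real \<Rightarrow> complex) \<Rightarrow> bool" where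
  "analytic_mother_wavelet \<psi> \<longleftrightarrow>
     integrable lborel \<psi> \<and> integrable lborel (\<lambda>t. (cmod (\<psi> t))\<^sup>2) \<and>
     (\<forall>\<omega>\<le>0. fourier \<psi> \<omega> = 0) \<and>
     (\<exists>p>0. unimodal_with_peak (\<lambda>\<omega>. cmod (fourier \<psi> \<omega>)) p)"

subsection \<open>Stationary Gaussian processes\<close>

text \<open>A process is indexed time first: \<open>\<Phi> t\<close> is the random variable at time \<open>t\<close>.\<close>

text \<open>Degenerate (almost surely constant) variables count as Gaussian.\<close>

definition gaussian_rv :: "'a measure \<Rightarrow> ('a \<Rightarrow> real) \<Rightarrow> bool" where
  "gaussian_rv M X \<longleftrightarrow> X \<in> borel_measurable M \<and>
     ((\<exists>\<mu> \<sigma>. 0 < \<sigma> \<and> distributed M lborel X (normal_density \<mu> \<sigma>)) \<or>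
      (\<exists>\<mu>. AE x in M. X x = \<mu>))"

text \<open>All finite-dimensional distributions are multivariate normal, i.e. every finite linear
  combination is a Gaussian variable.\<close>

definition gaussian_process :: "'a measure \<Rightarrow> (real \<Rightarrow> 'a \<Rightarrow> real) \<Rightarrow> bool" where
  "gaussian_process M \<Phi> \<longleftrightarrow>
     (\<forall>T a. finite T \<longrightarrow> gaussian_rv M (\<lambda>x. \<Sum>t\<in>T. a t * \<Phi> t x))"

definition covariance :: "'a measure \<Rightarrow> ('a \<Rightarrow> real) \<Rightarrow> ('a \<Rightarrow> real) \<Rightarrow> real" where
  "covariance M X Y =
     (LINT x|M. (X x - (LINT y|M. X y)) * (Y x - (LINT y|M. Y y)))"

text \<open>For a Gaussian process this second-order condition is equivalent to invariance of all
  finite-dimensional distributions under time shifts.\<close>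

definition stationary_with_covariance ::
  "'a measure \<Rightarrow> (real \<Rightarrow> 'a \<Rightarrow> real) \<Rightarrow> (real \<Rightarrow> real) \<Rightarrow> bool" where
  "stationary_with_covariance M \<Phi> C \<longleftrightarrow>
     (\<exists>\<mu>. \<forall>t. (LINT x|M. \<Phi> t x) = \<mu>) \<and>
     (\<forall>t1 t2. covariance M (\<Phi> t1) (\<Phi> t2) = C (t1 - t2))"

text \<open>The second conjunct makes \<open>F\<close> a finite measure.\<close>

definition spectral_measure_of :: "real measure \<Rightarrow> (real \<Rightarrow> real) \<Rightarrow> bool" where
  "spectral_measure_of F C \<longleftrightarrow>
     sets F = sets borel \<and> emeasure F UNIV = ennreal (C 0) \<and>
     (\<forall>t. complex_of_real (C t) = (CLINT l|F. exp (\<i> * of_real (l * t))))"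

text \<open>Joint measurability gives the path integral in \<open>wavelet_transform\<close> a meaning.\<close>

definition jointly_measurable :: "'a measure \<Rightarrow> (real \<Rightarrow> 'a \<Rightarrow> real) \<Rightarrow> bool" where
  "jointly_measurable M \<Phi> \<longleftrightarrow> case_prod \<Phi> \<in> borel_measurable (borel \<Otimes>\<^sub>M M)"

subsection \<open>The wavelet transform of a process\<close>

text \<open>For a jointly measurable stationary Gaussian process and an integrable \<open>\<psi>\<close> the integral
  converges absolutely for almost every sample path; on the exceptional null set its value is
  the default 0.\<close>

definition wavelet_transform ::
  "(real \<Rightarrow> complex) \<Rightarrow> (real \<Rightarrow> 'a \<Rightarrow> real) \<Rightarrow> real \<Rightarrow> real \<Rightarrow> 'a \<Rightarrow> complex" where
  "wavelet_transform \<psi> \<Phi> t s x =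
     (CLINT \<tau>|lborel. of_real (\<Phi> \<tau> x) * of_real (1 / sqrt s) * cnj (\<psi> ((\<tau> - t) / s)))"

text \<open>\<open>Arg2pi\<close> takes values in \<open>[0,2\<pi>)\<close>; at 0, where the phase is not
  determined, it is 0.\<close>

definition wavelet_phase ::
  "(real \<Rightarrow> complex) \<Rightarrow> (real \<Rightarrow> 'a \<Rightarrow> real) \<Rightarrow> real \<Rightarrow> real \<Rightarrow> 'a \<Rightarrow> real" where
  "wavelet_phase \<psi> \<Phi> t s x = Arg2pi (wavelet_transform \<psi> \<Phi> t s x)"

definition conj_transpose :: "complex^'n^'m \<Rightarrow> complex^'m^'n" where
  "conj_transpose A = (\<chi> i j. cnj (A $ j $ i))"

text \<open>The matrix \<open>E[W W\<^sup>*]\<close>, with \<open>W\<close> a column vector, i.e. a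
  two-by-one matrix.\<close>

definition second_moment_matrix :: "'a measure \<Rightarrow> ('a \<Rightarrow> complex^2) \<Rightarrow> complex^2^2" where
  "second_moment_matrix M W =
     (LINT x|M. (columnvector (W x) :: complex^1^2) ** conj_transpose (columnvector (W x)))"

end

theory Submission
  imports Defs
begin

text \<open>Write \<open>W1\<close> and \<open>W2\<close> for the two wavelet coefficients. The pair \<open>(W1, W2)\<close> is a
circularly symmetric complex Gaussian vector: for \<open>cmod c = 1\<close> the pairs \<open>(c * W1, c * W2)\<close> and
\<open>(W1, W2)\<close> have the same law. Such a rotation fixes \<open>cmod W1\<close> and shifts the phase of
\<open>W2\<close>, so conditionally on \<open>cmod W1\<close> the phase of \<open>W2\<close> has a rotation invariant law.
There is only one such law on the circle, hence the independence
(\<open>indep_cmod_Arg2pi_if_rotation_invariant\<close>). Invertibility of the second moment matrix enters only to exclude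
\<open>W2 = 0\<close>, where the phase is undetermined: it forces \<open>W2\<close> to have positive mean squared modulus, and
then \<open>Re W2\<close> is a nondegenerate normal variable.

Circular symmetry has two sources. First, every linear combination \<open>a * W1 + b * W2\<close> is a path integral
\<open>\<integral> \<Phi> t * k t dt\<close> with \<open>k\<close> integrable, and its real part is Gaussian, being a mean-square limit of
finite linear combinations of the process (\<open>real_integral_approx_by_linear_combinations\<close>,
\<open>L2_limit_of_gaussian\<close>). Secondly, the wavelet is analytic, so that \<open>\<integral> k t * iexp (l * t) dt\<close>
vanishes for \<open>l \<le> 0\<close>. In the spectral representation the mean of the square of the path integral is the
integral over \<open>l\<close> of the product of these Fourier integrals at \<open>l\<close> and \<open>- l\<close>, and one
factor is always 0 (\<open>iterated_integral_stationary_eq_0\<close>); the mean of the path integral vanishes too. The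
characteristic function of the real part at 1 is therefore
\<open>exp (- E \<bar>a * W1 + b * W2\<bar>\<^sup>2 / 4)\<close>, which is invariant under a common rotation of \<open>a\<close> and
\<open>b\<close>. As a law on a Euclidean space is determined by its characteristic function
(\<open>Levy_uniqueness_euclidean\<close>), the law of the pair is rotation invariant.\<close>

section \<open>Characteristic functions on Euclidean spaces\<close>

lemma borel_measurable_cnj [measurable]: "cnj \<in> borel_measurable borel"
  by (intro borel_measurable_continuous_onI continuous_intros)

lemma integral_cnj_mult_iexp:
  "(CLINT x|M. cnj (f x) * iexp (u * X x)) = cnj (CLINT x|M. f x * iexp (- u * X x))"
  by (simp add: exp_cnj flip: Bochner_Integration.integral_cnj)

text \<open>After division by the common total mass \<open>c\<close> the weights become probability densities, and the
hypothesis says that \<open>X\<close> and \<open>Y\<close> have the same characteristic function under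
the reweighted measures, so the one-dimensional uniqueness theorem applies.\<close>

lemma Levy_uniqueness_weighted_nonneg:
  fixes f X :: "'a \<Rightarrow> real" and g Y :: "'b \<Rightarrow> real"
  assumes [measurable]: "X \<in> borel_measurable M" "Y \<in> borel_measurable N" "A \<in> sets borel"
    and f: "integrable M f" "\<And>x. 0 \<le> f x" and g: "integrable N g" "\<And>y. 0 \<le> g y"
    and eq: "\<And>u. (CLINT x|M. f x * iexp (u * X x)) = (CLINT y|N. g y * iexp (u * Y y))"
  shows "(LINT x|M. f x * indicator A (X x)) = (LINT y|N. g y * indicator A (Y y))"
proof -
  note [measurable] = borel_measurable_integrable[OF f(1)] borel_measurable_integrable[OF g(1)]
  define c where "c = (LINT x|M. f x)"
  have c: "c = (LINT y|N. g y)"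
    using eq[of 0] by (simp add: c_def)
  show ?thesis
  proof (cases "c = 0")
    case True
    have "AE x in M. f x = 0" 
      using True f by (subst (asm) c_def) (simp add: integral_nonneg_eq_0_iff_AE)
    moreover have "AE y in N. g y = 0" 
      using True g by (subst (asm) c) (simp add: integral_nonneg_eq_0_iff_AE)
    ultimately have "(LINT x|M. f x * indicator A (X x)) = 0" 
       "(LINT y|N. g y * indicator A (Y y)) = 0"
      by (auto intro!: integral_eq_zero_AE)
    then show ?thesis by simp
  next
    case False
    then have pos: "c > 0" using f(2) by (metis c_def integral_nonneg_AE AE_I2 order_le_less)
    have main: "prob_space (density K (\<lambda>x. h x / c))
        \<and> char (distr (density K (\<lambda>x. h x / c)) borel Z) u = (CLINT x|K. h x * iexp (u * Z x)) / c
        \<and> measure (distr (density K (\<lambda>x. h x / c)) borel Z) A = (LINT x|K. h x * indicator A (Z x)) / c"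
      if h: "integrable K h" "\<And>x. 0 \<le> h x" "(LINT x|K. h x) = c" and [measurable]: "Z \<in> borel_measurable K"
      for K :: "'c measure" and h Z u
    proof -
      note [measurable] = borel_measurable_integrable[OF h(1)]
      interpret D: prob_space "density K (\<lambda>x. h x / c)"
      proof
        have "emeasure (density K (\<lambda>x. h x / c)) (space K) = (\<integral>\<^sup>+x. h x / c \<partial>K)"
          by (simp add: emeasure_density)
        also have "\<dots> = ennreal (LINT x|K. h x / c)"
          using h pos by (intro nn_integral_eq_integral) auto
        finally show "emeasure (density K (\<lambda>x. h x / c)) (space (density K (\<lambda>x. h x / c))) = 1"
          using h pos by simp
      qed
      have "char (distr (density K (\<lambda>x. h x / c)) borel Z) u
          = (CLINT x|K. (h x / c) *\<^sub>R iexp (u * Z x))"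
        unfolding char_def using pos h by (simp add: integral_distr integral_density)
      also have "\<dots> = (CLINT x|K. h x * iexp (u * Z x) / c)"
        by (simp add: scaleR_conv_of_real)
      also have "\<dots> = (CLINT x|K. h x * iexp (u * Z x)) / c" by simp
      finally have 1: "char (distr (density K (\<lambda>x. h x / c)) borel Z) u = (CLINT x|K. h x * iexp (u * Z x)) / c" .
      have "measure (distr (density K (\<lambda>x. h x / c)) borel Z) A
          = (LINT x|density K (\<lambda>x. h x / c). indicator A (Z x))"
        by (subst integral_distr[symmetric, where N=borel and f="indicator A :: real \<Rightarrow> real"]) auto
      also have "\<dots> = (LINT x|K. (h x / c) * indicator A (Z x))"
        using pos h by (subst integral_density) auto
      finally have "measure (distr (density K (\<lambda>x. h x / c)) borel Z) A = (LINT x|K. h x * indicator A (Z x)) / c"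
        by simp
      with 1 D.prob_space_axioms show ?thesis by blast
    qed
    note mX = main[OF f c_def[symmetric] assms(1)]
    note mY = main[OF g c[symmetric] assms(2)]
    have "distr (density M (\<lambda>x. f x / c)) borel X = distr (density N (\<lambda>x. g x / c)) borel Y"
    proof (rule Levy_uniqueness)
      show "real_distribution (distr (density M (\<lambda>x. f x / c)) borel X)"
        using mX by (intro prob_space.real_distribution_distr) auto
      show "real_distribution (distr (density N (\<lambda>x. g x / c)) borel Y)"
        using mY by (intro prob_space.real_distribution_distr) auto
      show "char (distr (density M (\<lambda>x. f x / c)) borel X) = char (distr (density N (\<lambda>x. g x / c)) borel Y)"
        using mX mY eq by auto
    qed
    then show ?thesis using mX mY pos by (metis divide_cancel_right False)
  qed
qed

text \<open>Complex weights of modulus at most 1 reduce to nonnegative ones: conjugating the hypothesis at \<open>-u\<close>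
gives it for \<open>Re f\<close>, and adding the unweighted hypothesis gives it for the nonnegative weight
\<open>1 + Re f\<close>. The imaginary part of \<open>f\<close> is the real part of \<open>- \<i> * f\<close>. In the
multidimensional theorem the weight is the part of the integrand that concerns the other coordinates.\<close>

lemma Levy_uniqueness_weighted:
  fixes X :: "'a \<Rightarrow> real" and Y :: "'b \<Rightarrow> real" and f :: "'a \<Rightarrow> complex" and g :: "'b \<Rightarrow> complex"
  assumes "prob_space M" "prob_space N"
    and [measurable]: "X \<in> borel_measurable M" "Y \<in> borel_measurable N" "A \<in> sets borel"
    and [measurable]: "f \<in> borel_measurable M" and f: "\<And>x. cmod (f x) \<le> 1"
    and [measurable]: "g \<in> borel_measurable N" and g: "\<And>y. cmod (g y) \<le> 1"
    and eq1: "\<And>u. (CLINT x|M. iexp (u * X x)) = (CLINT y|N. iexp (u * Y y))"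
    and eq: "\<And>u. (CLINT x|M. f x * iexp (u * X x)) = (CLINT y|N. g y * iexp (u * Y y))"
  shows "(CLINT x|M. indicator A (X x) * f x) = (CLINT y|N. indicator A (Y y) * g y)"
proof -
  interpret M: prob_space M by fact
  interpret N: prob_space N by fact
  have i1: "integrable M (\<lambda>x. iexp (u * X x))" "integrable N (\<lambda>y. iexp (u * Y y))" for u
    by (auto intro!: M.integrable_iexp N.integrable_iexp)
  have ind: "(LINT x|M. indicator A (X x)) = (LINT y|N. indicator A (Y y) :: real)"
    using Levy_uniqueness_weighted_nonneg[where f="\<lambda>_. 1" and g="\<lambda>_. 1" and M=M and N=N and X=X and Y=Y and A=A] eq1
    by simp
  have re: "(LINT x|M. indicator A (X x) * Re (f x)) = (LINT y|N. indicator A (Y y) * Re (g y))"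
    if [measurable]: "f \<in> borel_measurable M" and f: "\<And>x. cmod (f x) \<le> 1"
    and [measurable]: "g \<in> borel_measurable N" and g: "\<And>y. cmod (g y) \<le> 1"
    and eq: "\<And>u. (CLINT x|M. f x * iexp (u * X x)) = (CLINT y|N. g y * iexp (u * Y y))"
    for f g
  proof -
    have bf: "\<bar>Re (f x)\<bar> \<le> 1" "\<bar>Re (g y)\<bar> \<le> 1" for x y
      using f g abs_Re_le_cmod order_trans by blast+
    have pf: "0 \<le> 1 + Re (f x)" "0 \<le> 1 + Re (g y)" for x y
      using bf(1)[of x] bf(2)[of y] by linarith+
    have if': "integrable M (\<lambda>x. f x * iexp (u * X x))" "integrable N (\<lambda>y. g y * iexp (u * Y y))" for u
      using f g by (auto intro!: M.integrable_const_bound[where B=1] N.integrable_const_bound[where B=1] simp: norm_mult)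
    have ic: "integrable M (\<lambda>x. cnj (f x) * iexp (u * X x))" "integrable N (\<lambda>y. cnj (g y) * iexp (u * Y y))" for u
      using f g by (auto intro!: M.integrable_const_bound[where B=1] N.integrable_const_bound[where B=1] simp: norm_mult)
    have iR: "integrable M (\<lambda>x. Re (f x))" "integrable N (\<lambda>y. Re (g y))"
      using bf by (auto intro!: M.integrable_const_bound[where B=1] N.integrable_const_bound[where B=1])
    have iRA: "integrable M (\<lambda>x. indicator A (X x) * Re (f x))" "integrable N (\<lambda>y. indicator A (Y y) * Re (g y))"
      using bf by (auto intro!: M.integrable_const_bound[where B=1] N.integrable_const_bound[where B=1] simp: abs_mult split: split_indicator)
    have iA: "integrable M (\<lambda>x. indicator A (X x) :: real)" "integrable N (\<lambda>y. indicator A (Y y) :: real)"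
      by (auto intro!: M.integrable_const_bound[where B=1] N.integrable_const_bound[where B=1] split: split_indicator)
    have h: "(1 + Re z) * w = w + (z * w + cnj z * w) / 2" for z w :: complex
      by (simp add: complex_eq_iff field_simps)
    have "(LINT x|M. (1 + Re (f x)) * indicator A (X x)) = (LINT y|N. (1 + Re (g y)) * indicator A (Y y))"
    proof (rule Levy_uniqueness_weighted_nonneg)
      fix u
      have "(CLINT x|M. cnj (f x) * iexp (u * X x)) = (CLINT y|N. cnj (g y) * iexp (u * Y y))"
        by (simp only: integral_cnj_mult_iexp eq)
      then show "(CLINT x|M. (1 + Re (f x)) * iexp (u * X x)) = (CLINT y|N. (1 + Re (g y)) * iexp (u * Y y))"
        using eq[of u] eq1[of u]
        unfolding h
        by (subst (1 2) Bochner_Integration.integral_add)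
           (use i1 if' ic in \<open>simp_all del: Bochner_Integration.integral_cnj\<close>)
    qed (use iR pf in auto)
    then show ?thesis using iRA iA ind by (simp add: algebra_simps)
  qed
  have iC: "integrable M (\<lambda>x. indicator A (X x) * f x)" "integrable N (\<lambda>y. indicator A (Y y) * g y)"
    using f g by (auto intro!: M.integrable_const_bound[where B=1] N.integrable_const_bound[where B=1] simp: norm_mult split: split_indicator)
  have Re: "Re (indicator B z) = indicator B z" "Im (indicator B z) = 0" for B and z :: real
    by (auto split: split_indicator)
  show ?thesis
  proof (rule complex_eqI)
    show "Re (CLINT x|M. indicator A (X x) * f x) = Re (CLINT y|N. indicator A (Y y) * g y)"
      using re[of f g] f g eq iC by (simp add: Re flip: integral_Re)
    show "Im (CLINT x|M. indicator A (X x) * f x) = Im (CLINT y|N. indicator A (Y y) * g y)"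
      using re[of "\<lambda>x. - \<i> * f x" "\<lambda>y. - \<i> * g y"] f g eq iC
      by (simp add: Re norm_mult mult.assoc flip: integral_Im)
  qed
qed

text \<open>The exponential is exchanged for indicators one coordinate at a time. Once the coordinates in \<open>S\<close>
carry indicators \<open>A b\<close>, the product of these with \<open>iexp (x \<bullet> t)\<close> is a bounded complex
weight, and varying the coordinate of \<open>t\<close> along a further basis vector \<open>c\<close> gives the
hypothesis of the weighted one-dimensional theorem for \<open>x \<bullet> c\<close>. When every coordinate has
been treated and \<open>t = 0\<close>, the measures agree on boxes.\<close>

theorem Levy_uniqueness_euclidean:
  fixes M N :: "'a::euclidean_space measure"
  assumes "prob_space M" "prob_space N" and [measurable_cong]: "sets M = sets borel" "sets N = sets borel"
    and eq: "\<And>t. (CLINT x|M. iexp (x \<bullet> t)) = (CLINT x|N. iexp (x \<bullet> t))"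
  shows "M = N"
proof -
  interpret M: prob_space M by fact
  interpret N: prob_space N by fact
  have step: "(CLINT x|M. (\<Prod>b\<in>S. indicator (A b) (x \<bullet> b)) * iexp (x \<bullet> t))
      = (CLINT x|N. (\<Prod>b\<in>S. indicator (A b) (x \<bullet> b)) * iexp (x \<bullet> t))"
    if "finite S" and A: "\<And>b. b \<in> S \<Longrightarrow> A b \<in> sets borel" for S A and t :: 'a
    using that
  proof (induction S arbitrary: t)
    case empty
    then show ?case using eq by simp
  next
    case (insert c S)
    note [measurable] = insert.prems[OF insertI2] insert.prems[OF insertI1]
    let ?f = "\<lambda>x. (\<Prod>b\<in>S. indicator (A b) (x \<bullet> b)) * iexp (x \<bullet> t)"
    have b: "cmod (?f x) \<le> 1" for x
      by (auto simp: norm_mult prod_norm[symmetric] intro!: prod_le_1 split: split_indicator)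
    have "(CLINT x|M. indicator (A c) (x \<bullet> c) * ?f x) = (CLINT x|N. indicator (A c) (x \<bullet> c) * ?f x)"
    proof (rule Levy_uniqueness_weighted)
      fix u
      show "(CLINT x|M. iexp (u * (x \<bullet> c))) = (CLINT x|N. iexp (u * (x \<bullet> c)))"
        using eq[of "u *\<^sub>R c"] by simp
      have *: "?f x * iexp (u * (x \<bullet> c)) = (\<Prod>b\<in>S. indicator (A b) (x \<bullet> b)) * iexp (x \<bullet> (t + u *\<^sub>R c))" for x
        by (simp add: inner_add_right algebra_simps flip: exp_add)
      show "(CLINT x|M. ?f x * iexp (u * (x \<bullet> c))) = (CLINT x|N. ?f x * iexp (u * (x \<bullet> c)))"
        unfolding * using insert by auto
    qed (use b assms(1,2) in auto)
    then show ?case using insert.hyps by (simp add: mult.assoc)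
  qed
  let ?E = "range (\<lambda>(a, b). box a b :: 'a set)"
  show "M = N"
  proof (rule measure_eqI_generator_eq[where A="\<lambda>n. box (- real n *\<^sub>R One) (real n *\<^sub>R One)"])
    show "Int_stable ?E"
      by (auto simp: Int_stable_def Int_interval image_iff box_Int_box)
    show "?E \<subseteq> Pow UNIV" by auto
    show "sets M = sigma_sets UNIV ?E" "sets N = sigma_sets UNIV ?E"
      using assms(3,4) by (auto simp: borel_eq_box)
    show "range (\<lambda>n. box (- real n *\<^sub>R One) (real n *\<^sub>R One)) \<subseteq> ?E" by auto
    show "(\<Union>n. box (- real n *\<^sub>R One) (real n *\<^sub>R One :: 'a)) = UNIV"
      using UN_box_eq_UNIV by simp
    show "emeasure M (box (- real n *\<^sub>R One) (real n *\<^sub>R One)) \<noteq> \<infinity>" for n by simp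
    fix X :: "'a set" assume "X \<in> ?E"
    then obtain a b where X: "X = box a b" by auto
    have ind: "(\<Prod>i\<in>Basis. indicator {a \<bullet> i <..< b \<bullet> i} (x \<bullet> i)) = (indicator X x :: complex)" for x
      by (auto simp: X box_def indicator_def prod_zero_iff)
    have of_real_ind: "(indicator X x :: complex) = of_real (indicator X x)" for x
      by (simp split: split_indicator)
    have "complex_of_real (measure M X) = complex_of_real (measure N X)"
      using step[of Basis "\<lambda>i. {a \<bullet> i <..< b \<bullet> i}" 0]
        sets_eq_imp_space_eq[OF assms(3)] sets_eq_imp_space_eq[OF assms(4)]
      unfolding ind of_real_ind by simp
    then show "emeasure M X = emeasure N X"
      by (simp add: M.emeasure_eq_measure N.emeasure_eq_measure)
  qed
qed

section \<open>Modulus and phase of rotation invariant pairs\<close>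

lemma borel_measurable_Arg2pi [measurable]: "Arg2pi \<in> borel_measurable borel"
proof (rule borel_measurableI_le)
  fix t show "{w \<in> space borel. Arg2pi w \<le> t} \<in> sets borel"
    using closed_Arg2pi2pi_le[of t] by simp
qed

text \<open>Let \<open>p\<close> be the probability that \<open>cmod W1\<close> lies in \<open>A\<close> and the phase of
\<open>W2\<close> lies in \<open>B\<close>. By invariance \<open>W2\<close> may be replaced here by
\<open>v * W2\<close> for any fixed \<open>v \<noteq> 0\<close>, as only the direction of \<open>v\<close> affects the
phase. Take for \<open>v\<close> an independent copy of \<open>W2\<close> and integrate: the result is still
\<open>p\<close>. Carrying out the integration over the copy first instead, the same invariance turns the phase of
\<open>v * W2\<close> into that of the copy, no matter what \<open>W2\<close> is, so the integral is the product
of the two probabilities. This avoids computing the uniform law of the phase.\<close>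

lemma (in prob_space) indep_cmod_Arg2pi_if_rotation_invariant:
  assumes [measurable]: "W1 \<in> borel_measurable M" "W2 \<in> borel_measurable M"
    and inv: "\<And>c. cmod c = 1 \<Longrightarrow>
      distr M borel (\<lambda>x. (c * W1 x, c * W2 x)) = distr M borel (\<lambda>x. (W1 x, W2 x))"
    and nz: "AE x in M. W2 x \<noteq> 0"
  shows "indep_var borel (\<lambda>x. cmod (W1 x)) borel (\<lambda>x. Arg2pi (W2 x))"
proof -
  interpret P: pair_sigma_finite M M ..
  have key: "(\<integral>\<^sup>+x. indicator A (cmod (W1 x)) * indicator B (Arg2pi (W2 x)) \<partial>M)
      = (\<integral>\<^sup>+x. indicator A (cmod (W1 x)) \<partial>M) * (\<integral>\<^sup>+x. indicator B (Arg2pi (W2 x)) \<partial>M)" (is "?p = ?a * ?q")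
    if [measurable]: "A \<in> sets borel" "B \<in> sets borel" for A B
  proof -
    \<comment> \<open>Rotating the pair by \<open>sgn v\<close> leaves \<open>cmod W1\<close> unchanged; \<open>C = UNIV\<close> gives the invariance of the phase alone.\<close>
    have rot: "(\<integral>\<^sup>+x. indicator C (cmod (W1 x)) * indicator B (Arg2pi (v * W2 x)) \<partial>M)
        = (\<integral>\<^sup>+x. indicator C (cmod (W1 x)) * indicator B (Arg2pi (W2 x)) \<partial>M)"
      if "v \<noteq> 0" and [measurable]: "C \<in> sets borel" for v and C :: "real set"
    proof -
      have c: "cmod (sgn v) = 1" using \<open>v \<noteq> 0\<close> by (simp add: norm_sgn)
      have Arg: "Arg2pi (v * w) = Arg2pi (sgn v * w)" for w
      proof -
        have "v * w = of_real (cmod v) * (sgn v * w)"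
          using \<open>v \<noteq> 0\<close> by (simp add: sgn_eq)
        then show ?thesis using \<open>v \<noteq> 0\<close> by (simp only: Arg2pi_times_of_real zero_less_norm_iff simp_thms)
      qed
      let ?h = "\<lambda>z. indicator C (cmod (fst z)) * indicator B (Arg2pi (snd z)) :: ennreal"
      have [measurable]: "?h \<in> borel_measurable borel"
        unfolding borel_prod[symmetric] by measurable
      have "(\<integral>\<^sup>+x. ?h (sgn v * W1 x, sgn v * W2 x) \<partial>M) = (\<integral>\<^sup>+x. ?h (W1 x, W2 x) \<partial>M)"
        using arg_cong[OF inv[OF c], of "\<lambda>K. \<integral>\<^sup>+z. ?h z \<partial>K"]
        by (simp add: nn_integral_distr flip: borel_prod)
      then show ?thesis by (simp add: Arg norm_mult c)
    qed
    \<comment> \<open>The variable \<open>y\<close> runs over the independent copy.\<close>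
    have "?p = (\<integral>\<^sup>+y. (\<integral>\<^sup>+x. indicator A (cmod (W1 x)) * indicator B (Arg2pi (W2 y * W2 x)) \<partial>M) \<partial>M)"
      using nz by (subst nn_integral_cong_AE[where v="\<lambda>_. ?p"]) (auto simp: rot emeasure_space_1)
    also have "\<dots> = (\<integral>\<^sup>+x. (\<integral>\<^sup>+y. indicator A (cmod (W1 x)) * indicator B (Arg2pi (W2 y * W2 x)) \<partial>M) \<partial>M)"
      by (rule P.Fubini') measurable
    also have "\<dots> = (\<integral>\<^sup>+x. indicator A (cmod (W1 x)) * ?q \<partial>M)"
    proof (rule nn_integral_cong_AE, use nz in eventually_elim)
      fix x assume "W2 x \<noteq> 0"
      then show "(\<integral>\<^sup>+y. indicator A (cmod (W1 x)) * indicator B (Arg2pi (W2 y * W2 x)) \<partial>M)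
          = indicator A (cmod (W1 x)) * ?q"
        using rot[of "W2 x" UNIV] by (simp add: nn_integral_cmult mult.commute)
    qed
    finally show ?thesis by (simp add: nn_integral_multc)
  qed
  show ?thesis
    unfolding indep_var_distribution_eq
  proof (intro conjI)
    show "distr M borel (\<lambda>x. cmod (W1 x)) \<Otimes>\<^sub>M distr M borel (\<lambda>x. Arg2pi (W2 x))
        = distr M (borel \<Otimes>\<^sub>M borel) (\<lambda>x. (cmod (W1 x), Arg2pi (W2 x)))"
    proof (rule pair_measure_eqI)
      show "sigma_finite_measure (distr M borel (\<lambda>x. cmod (W1 x)))"
           "sigma_finite_measure (distr M borel (\<lambda>x. Arg2pi (W2 x)))"
        by (intro finite_measure.sigma_finite_measure finite_measure_distr; measurable)+
      fix A B assume "A \<in> sets (distr M borel (\<lambda>x. cmod (W1 x)))" "B \<in> sets (distr M borel (\<lambda>x. Arg2pi (W2 x)))"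
      then have [measurable]: "A \<in> sets borel" "B \<in> sets borel" by auto
      have "emeasure M (f -` C \<inter> space M) = (\<integral>\<^sup>+x. indicator C (f x) \<partial>M)"
        if [measurable]: "f \<in> borel_measurable M" "C \<in> sets borel" for f :: "'a \<Rightarrow> real" and C
      proof -
        have "(\<integral>\<^sup>+x. indicator C (f x) \<partial>M) = (\<integral>\<^sup>+x. indicator (f -` C \<inter> space M) x \<partial>M)"
          by (intro nn_integral_cong) (auto split: split_indicator)
        then show ?thesis by simp
      qed
      moreover have "emeasure M ((\<lambda>x. (cmod (W1 x), Arg2pi (W2 x))) -` (A \<times> B) \<inter> space M)
          = (\<integral>\<^sup>+x. indicator A (cmod (W1 x)) * indicator B (Arg2pi (W2 x)) \<partial>M)"
      proof -
        have "(\<integral>\<^sup>+x. indicator A (cmod (W1 x)) * indicator B (Arg2pi (W2 x)) \<partial>M)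
            = (\<integral>\<^sup>+x. indicator ((\<lambda>x. (cmod (W1 x), Arg2pi (W2 x))) -` (A \<times> B) \<inter> space M) x \<partial>M)"
          by (intro nn_integral_cong) (auto split: split_indicator)
        then show ?thesis by simp
      qed
      ultimately show "emeasure (distr M borel (\<lambda>x. cmod (W1 x))) A * emeasure (distr M borel (\<lambda>x. Arg2pi (W2 x))) B
          = emeasure (distr M (borel \<Otimes>\<^sub>M borel) (\<lambda>x. (cmod (W1 x), Arg2pi (W2 x)))) (A \<times> B)"
        using key by (simp add: emeasure_distr)
    qed (auto intro!: sets_pair_measure_cong)
  qed measurable
qed

section \<open>Gaussian variables and mean-square limits\<close>

text \<open>The formula for the characteristic function depends on the variable only through its first two moments and
includes almost surely constant variables (variance 0); in this form it passes to mean-square limits.\<close>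

lemma (in prob_space) gaussian_rv_moments:
  assumes "gaussian_rv M X"
  shows "X \<in> borel_measurable M" "integrable M (\<lambda>x. (X x)\<^sup>2)"
    and "expectation (\<lambda>x. iexp (X x))
      = iexp (expectation X) * exp (- of_real (expectation (\<lambda>x. (X x)\<^sup>2) - (expectation X)\<^sup>2) / 2)"
proof -
  show [measurable]: "X \<in> borel_measurable M" using assms by (simp add: gaussian_rv_def)
  have "integrable M (\<lambda>x. (X x)\<^sup>2) \<and> expectation (\<lambda>x. iexp (X x))
      = iexp (expectation X) * exp (- of_real (expectation (\<lambda>x. (X x)\<^sup>2) - (expectation X)\<^sup>2) / 2)"
    using assms unfolding gaussian_rv_def
  proof (elim conjE disjE exE)
    fix \<mu> assume ae: "AE x in M. X x = \<mu>"
    have "expectation X = expectation (\<lambda>_. \<mu>)" 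
      using ae by (intro integral_cong_AE) auto
    moreover have "expectation (\<lambda>x. (X x)\<^sup>2) = expectation (\<lambda>_. \<mu>\<^sup>2)"
      using ae by (intro integral_cong_AE) auto
    moreover have "expectation (\<lambda>x. iexp (X x)) = expectation (\<lambda>_. iexp \<mu>)"
      using ae by (intro integral_cong_AE) auto
    moreover have "integrable M (\<lambda>x. (X x)\<^sup>2)"
      using ae by (subst integrable_cong_AE[where g="\<lambda>_. \<mu>\<^sup>2"]) auto
    ultimately show ?thesis by (simp add: prob_space)
  next
    fix \<mu> \<sigma> :: real assume [arith]: "0 < \<sigma>" and D: "distributed M lborel X (normal_density \<mu> \<sigma>)"
    define Z where "Z = (\<lambda>x. (X x - \<mu>) / \<sigma>)"
    have Z: "distributed M lborel Z std_normal_density"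
      using D normal_standard_normal_convert[of \<sigma> X \<mu>] by (simp add: Z_def)
    have [measurable]: "Z \<in> borel_measurable M" unfolding Z_def by measurable
    have X: "X x = \<mu> + \<sigma> * Z x" for x by (simp add: Z_def)
    have "integrable M (\<lambda>x. (X x - \<mu>)\<^sup>2)"
      using distributed_integrable[OF D, of "\<lambda>x. (x - \<mu>)\<^sup>2"] integrable_normal_moment[of \<sigma> \<mu> 2] by simp
    moreover have iX: "integrable M X"
      using distributed_integrable[OF D, of "\<lambda>x. x"] integrable_normal_moment_nz_1[of \<sigma> \<mu>] by simp
    ultimately have "integrable M (\<lambda>x. (X x - \<mu>)\<^sup>2 + 2 * \<mu> * X x - \<mu>\<^sup>2)" by simp
    then have i2: "integrable M (\<lambda>x. (X x)\<^sup>2)" by (simp add: power2_eq_square algebra_simps)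
    have "variance X = \<sigma>\<^sup>2" "expectation X = \<mu>"
      using normal_distributed_variance[OF _ D] normal_distributed_expectation[OF _ D] by auto
    moreover have "expectation (\<lambda>x. iexp (X x)) = iexp \<mu> * exp (- of_real (\<sigma>\<^sup>2) / 2)"
    proof -
      have "expectation (\<lambda>x. iexp (X x)) = expectation (\<lambda>x. iexp \<mu> * iexp (\<sigma> * Z x))"
        by (simp add: X distrib_left exp_add)
      also have "\<dots> = iexp \<mu> * expectation (\<lambda>x. iexp (\<sigma> * Z x))" by simp
      also have "expectation (\<lambda>x. iexp (\<sigma> * Z x)) = (CLINT z|distr M lborel Z. iexp (\<sigma> * z))"
        by (subst integral_distr) auto
      also have "\<dots> = char std_normal_distribution \<sigma>"
        using distributed_distr_eq_density[OF Z] by (simp add: char_def)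
      finally show ?thesis by (simp add: char_std_normal_distribution flip: exp_of_real)
    qed
    moreover have "\<sigma>\<^sup>2 = expectation (\<lambda>x. (X x)\<^sup>2) - \<mu>\<^sup>2"
      using calculation variance_eq[OF iX i2] by simp
    ultimately show ?thesis using i2 by metis
  qed
  then show "integrable M (\<lambda>x. (X x)\<^sup>2)"
    "expectation (\<lambda>x. iexp (X x))
      = iexp (expectation X) * exp (- of_real (expectation (\<lambda>x. (X x)\<^sup>2) - (expectation X)\<^sup>2) / 2)"
    by auto
qed

lemma integrable_mult_of_square_integrable:
  fixes f g :: "'a \<Rightarrow> 'b :: {real_normed_field, banach, second_countable_topology}"
  assumes [measurable]: "f \<in> borel_measurable M" "g \<in> borel_measurable M"
    and "integrable M (\<lambda>x. (norm (f x))\<^sup>2)" "integrable M (\<lambda>x. (norm (g x))\<^sup>2)"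
  shows "integrable M (\<lambda>x. f x * g x)"
proof (rule Bochner_Integration.integrable_bound)
  show "integrable M (\<lambda>x. ((norm (f x))\<^sup>2 + (norm (g x))\<^sup>2) / 2)" using assms by auto
  have "norm (f x * g x) \<le> ((norm (f x))\<^sup>2 + (norm (g x))\<^sup>2) / 2" for x
    using sum_squares_bound[of "norm (f x)" "norm (g x)"] by (simp add: norm_mult field_simps)
  then show "AE x in M. norm (f x * g x) \<le> norm (((norm (f x))\<^sup>2 + (norm (g x))\<^sup>2) / 2)"
    by (intro AE_I2) (smt (verit) real_norm_def)
qed simp

lemma (in prob_space) expectation_abs_mult_le:
  fixes X Y :: "'a \<Rightarrow> real"
  assumes [measurable]: "X \<in> borel_measurable M" "Y \<in> borel_measurable M"
    and X: "integrable M (\<lambda>x. (X x)\<^sup>2)" and Y: "integrable M (\<lambda>x. (Y x)\<^sup>2)"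
  shows "expectation (\<lambda>x. \<bar>X x * Y x\<bar>) \<le> sqrt (expectation (\<lambda>x. (X x)\<^sup>2)) * sqrt (expectation (\<lambda>x. (Y x)\<^sup>2))"
proof -
  have XY: "integrable M (\<lambda>x. \<bar>X x * Y x\<bar>)"
    using integrable_mult_of_square_integrable[of X M Y] X Y by simp
  have "ennreal ((expectation (\<lambda>x. \<bar>X x * Y x\<bar>))\<^sup>2) = (\<integral>\<^sup>+x. ennreal \<bar>X x\<bar> * ennreal \<bar>Y x\<bar> \<partial>M)\<^sup>2"
    using XY by (simp add: nn_integral_eq_integral ennreal_power flip: ennreal_mult abs_mult)
  also have "\<dots> \<le> (\<integral>\<^sup>+x. (ennreal \<bar>X x\<bar>)\<^sup>2 \<partial>M) * (\<integral>\<^sup>+x. (ennreal \<bar>Y x\<bar>)\<^sup>2 \<partial>M)"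
    by (rule Cauchy_Schwarz_nn_integral) auto
  also have "\<dots> = ennreal (expectation (\<lambda>x. (X x)\<^sup>2) * expectation (\<lambda>x. (Y x)\<^sup>2))"
    using X Y by (simp add: nn_integral_eq_integral ennreal_power ennreal_mult)
  finally have "(expectation (\<lambda>x. \<bar>X x * Y x\<bar>))\<^sup>2 \<le> expectation (\<lambda>x. (X x)\<^sup>2) * expectation (\<lambda>x. (Y x)\<^sup>2)"
    by (simp add: ennreal_le_iff)
  then show ?thesis by (simp add: real_le_rsqrt flip: real_sqrt_mult)
qed

text \<open>Mean-square convergence gives convergence of the first two moments, and of the characteristic functions because
\<open>iexp\<close> is 1-Lipschitz; hence the Gaussian formula survives in the limit.\<close>

lemma (in prob_space) L2_limit_of_gaussian:
  fixes S :: "nat \<Rightarrow> 'a \<Rightarrow> real"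
  assumes S: "\<And>n. gaussian_rv M (S n)"
    and [measurable]: "Y \<in> borel_measurable M" and Y: "integrable M (\<lambda>x. (Y x)\<^sup>2)"
    and lim: "(\<lambda>n. expectation (\<lambda>x. (Y x - S n x)\<^sup>2)) \<longlonglongrightarrow> 0"
  shows "expectation (\<lambda>x. iexp (Y x))
      = iexp (expectation Y) * exp (- of_real (expectation (\<lambda>x. (Y x)\<^sup>2) - (expectation Y)\<^sup>2) / 2)"
proof -
  note [measurable] = gaussian_rv_moments(1)[OF S]
  note S2 = gaussian_rv_moments(2)[OF S]
  define e where "e n = sqrt (expectation (\<lambda>x. (Y x - S n x)\<^sup>2))" for n
  have e: "e \<longlonglongrightarrow> 0" using tendsto_real_sqrt[OF lim] by (simp add: e_def[abs_def])
  have iS: "integrable M (S n)" for n by (rule square_integrable_imp_integrable[OF _ S2]) simp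
  have iY: "integrable M Y" by (rule square_integrable_imp_integrable[OF _ Y]) simp
  have iYS: "integrable M (\<lambda>x. Y x * S n x)" for n
    using integrable_mult_of_square_integrable[of Y M "S n"] Y S2 by simp
  have iD2: "integrable M (\<lambda>x. (Y x - S n x)\<^sup>2)" for n
    using Y S2[of n] iYS[of n] by (simp add: power2_diff mult.assoc)
  \<comment> \<open>Cauchy-Schwarz against the constant 1.\<close>
  have L1: "expectation (\<lambda>x. \<bar>Y x - S n x\<bar>) \<le> e n" for n
    using expectation_abs_mult_le[of "\<lambda>x. Y x - S n x" "\<lambda>_. 1"] iD2[of n] by (simp add: e_def prob_space)
  have A: "(\<lambda>n. expectation (S n)) \<longlonglongrightarrow> expectation Y"
  proof (rule LIM_zero_cancel, rule tendsto_0_le[OF e, of _ 1], rule always_eventually, rule allI)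
    fix n
    have "\<bar>expectation (\<lambda>x. Y x - S n x)\<bar> \<le> expectation (\<lambda>x. \<bar>Y x - S n x\<bar>)"
      by (rule integral_abs_bound)
    then show "norm (expectation (S n) - expectation Y) \<le> norm (e n) * 1"
      using L1[of n] iS iY by simp
  qed
  have B: "(\<lambda>n. expectation (\<lambda>x. (S n x)\<^sup>2)) \<longlonglongrightarrow> expectation (\<lambda>x. (Y x)\<^sup>2)"
  proof (rule LIM_zero_cancel, rule tendsto_0_le)
    let ?b = "\<lambda>n. (e n)\<^sup>2 + 2 * (sqrt (expectation (\<lambda>x. (Y x)\<^sup>2)) * e n)"
    have b: "\<bar>expectation (\<lambda>x. (S n x)\<^sup>2) - expectation (\<lambda>x. (Y x)\<^sup>2)\<bar> \<le> ?b n" for n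
    proof -
      have iYD: "integrable M (\<lambda>x. Y x * (Y x - S n x))"
        using iYS[of n] Y by (simp add: algebra_simps power2_eq_square)
      have "expectation (\<lambda>x. (S n x)\<^sup>2) - expectation (\<lambda>x. (Y x)\<^sup>2)
          = expectation (\<lambda>x. (Y x - S n x)\<^sup>2 - 2 * (Y x * (Y x - S n x)))"
        using S2 Y by (subst Bochner_Integration.integral_diff[symmetric])
          (auto intro!: Bochner_Integration.integral_cong simp: power2_eq_square algebra_simps)
      also have "\<dots> = (e n)\<^sup>2 - 2 * expectation (\<lambda>x. Y x * (Y x - S n x))"
        using iYD iD2[of n] by (simp add: e_def)
      finally have "\<bar>expectation (\<lambda>x. (S n x)\<^sup>2) - expectation (\<lambda>x. (Y x)\<^sup>2)\<bar>
          \<le> (e n)\<^sup>2 + 2 * \<bar>expectation (\<lambda>x. Y x * (Y x - S n x))\<bar>"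
        using zero_le_power2[of "e n"] by linarith
      moreover have "\<bar>expectation (\<lambda>x. Y x * (Y x - S n x))\<bar> \<le> expectation (\<lambda>x. \<bar>Y x * (Y x - S n x)\<bar>)"
        by (rule integral_abs_bound)
      moreover have "\<dots> \<le> sqrt (expectation (\<lambda>x. (Y x)\<^sup>2)) * e n"
        unfolding e_def using Y iD2[of n] by (intro expectation_abs_mult_le) auto
      ultimately show ?thesis by linarith
    qed
    show "\<forall>\<^sub>F n in sequentially. norm (expectation (\<lambda>x. (S n x)\<^sup>2) - expectation (\<lambda>x. (Y x)\<^sup>2)) \<le> norm (?b n) * 1"
      using order_trans[OF b abs_ge_self] by (auto intro!: always_eventually)
    show "?b \<longlonglongrightarrow> 0"
      by (auto intro!: tendsto_eq_intros e)
  qed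
  have C: "(\<lambda>n. expectation (\<lambda>x. iexp (S n x))) \<longlonglongrightarrow> expectation (\<lambda>x. iexp (Y x))"
  proof (rule LIM_zero_cancel, rule tendsto_0_le[OF e, of _ 1], rule always_eventually, rule allI)
    fix n
    have "norm (expectation (\<lambda>x. iexp (S n x) - iexp (Y x))) \<le> expectation (\<lambda>x. \<bar>Y x - S n x\<bar>)"
    proof (rule order_trans[OF Bochner_Integration.integral_norm_bound Bochner_Integration.integral_mono])
      show "integrable M (\<lambda>x. cmod (iexp (S n x) - iexp (Y x)))"
        by (intro integrable_norm Bochner_Integration.integrable_diff integrable_iexp) auto
      show "integrable M (\<lambda>x. \<bar>Y x - S n x\<bar>)" using iS iY by simp
      fix x
      have "iexp (S n x) - iexp (Y x) = iexp (Y x) * (iexp (S n x - Y x) - 1)"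
        by (simp add: algebra_simps flip: exp_add)
      then have "cmod (iexp (S n x) - iexp (Y x)) = cmod (iexp (S n x - Y x) - 1)"
        by (simp add: norm_mult)
      also have "\<dots> \<le> \<bar>S n x - Y x\<bar>" using iexp_approx1[of "S n x - Y x" 0] by simp
      finally show "cmod (iexp (S n x) - iexp (Y x)) \<le> \<bar>Y x - S n x\<bar>" by linarith
    qed
    then show "norm (expectation (\<lambda>x. iexp (S n x)) - expectation (\<lambda>x. iexp (Y x))) \<le> norm (e n) * 1"
      using L1[of n] by (subst Bochner_Integration.integral_diff[symmetric]) (auto intro!: integrable_iexp)
  qed
  have "(\<lambda>n. expectation (\<lambda>x. iexp (S n x))) \<longlonglongrightarrow>
      iexp (expectation Y) * exp (- of_real (expectation (\<lambda>x. (Y x)\<^sup>2) - (expectation Y)\<^sup>2) / 2)"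
    unfolding gaussian_rv_moments(3)[OF S] by (intro tendsto_intros A B) auto
  with C show ?thesis by (rule LIMSEQ_unique)
qed

section \<open>Path integrals of second-order processes\<close>

text \<open>A uniform bound on second moments is all that the \<open>L\<^sup>2\<close>-theory of the integrals
\<open>\<integral> \<Phi> t * g t dt\<close> needs when \<open>g\<close> is integrable.\<close>

locale bounded_second_order_process = prob_space M for M :: "'a measure" +
  fixes \<Phi> :: "real \<Rightarrow> 'a \<Rightarrow> real" and K :: real
  assumes measurable_process: "case_prod \<Phi> \<in> borel_measurable (borel \<Otimes>\<^sub>M M)"
    and square_integrable_process: "\<And>t. integrable M (\<lambda>x. (\<Phi> t x)\<^sup>2)"
    and second_moment_le: "\<And>t. expectation (\<lambda>x. (\<Phi> t x)\<^sup>2) \<le> K"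
begin

definition path_integral :: "(real \<Rightarrow> complex) \<Rightarrow> 'a \<Rightarrow> complex" where
  "path_integral g x = (CLINT t|lborel. of_real (\<Phi> t x) * g t)"

lemma measurable_process_lborel [measurable]: "case_prod \<Phi> \<in> borel_measurable (lborel \<Otimes>\<^sub>M M)"
  using measurable_process by (simp add: measurable_cong_sets[OF sets_pair_measure_cong[OF sets_lborel refl] refl])

lemma measurable_process_fixed [measurable]: "\<Phi> t \<in> borel_measurable M"
proof -
  have "(\<lambda>x. case_prod \<Phi> (t, x)) \<in> borel_measurable M" by measurable
  then show ?thesis by simp
qed

lemma measurable_path_integral [measurable]:
  assumes [measurable]: "g \<in> borel_measurable lborel"
  shows "path_integral g \<in> borel_measurable M"
  unfolding path_integral_def by measurable

lemma pair_sigma_finite_lborel: "pair_sigma_finite lborel M" ..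

lemma integrable_process_mult:
  fixes Z :: "'a \<Rightarrow> complex"
  assumes [measurable]: "Z \<in> borel_measurable M" and Z: "integrable M (\<lambda>x. (cmod (Z x))\<^sup>2)"
  shows "integrable M (\<lambda>x. of_real (\<Phi> t x) * Z x)"
    and "expectation (\<lambda>x. cmod (of_real (\<Phi> t x) * Z x)) \<le> (K + expectation (\<lambda>x. (cmod (Z x))\<^sup>2)) / 2"
proof -
  show *: "integrable M (\<lambda>x. of_real (\<Phi> t x) * Z x)"
    using square_integrable_process Z by (intro integrable_mult_of_square_integrable) auto
  have "expectation (\<lambda>x. cmod (of_real (\<Phi> t x) * Z x)) \<le> expectation (\<lambda>x. ((\<Phi> t x)\<^sup>2 + (cmod (Z x))\<^sup>2) / 2)"
  proof (rule integral_mono)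
    show "integrable M (\<lambda>x. cmod (of_real (\<Phi> t x) * Z x))" using * by (rule integrable_norm)
    fix x show "cmod (of_real (\<Phi> t x) * Z x) \<le> ((\<Phi> t x)\<^sup>2 + (cmod (Z x))\<^sup>2) / 2"
      using sum_squares_bound[of "\<bar>\<Phi> t x\<bar>" "cmod (Z x)"] by (simp add: norm_mult field_simps)
  qed (use square_integrable_process Z in auto)
  also have "\<dots> \<le> (K + expectation (\<lambda>x. (cmod (Z x))\<^sup>2)) / 2"
    using square_integrable_process Z second_moment_le[of t] by simp
  finally show "expectation (\<lambda>x. cmod (of_real (\<Phi> t x) * Z x)) \<le> (K + expectation (\<lambda>x. (cmod (Z x))\<^sup>2)) / 2" .
qed

text \<open>This is the absolute integrability behind every exchange of expectation and path integral: by
\<open>2 a b \<le> a\<^sup>2 + b\<^sup>2\<close> the mean of \<open>\<bar>\<Phi> t * Z\<bar>\<close> is bounded uniformly in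
\<open>t\<close>, so \<open>g\<close> alone accounts for integrability in time.\<close>

lemma integrable_process_product:
  fixes Z :: "'a \<Rightarrow> complex"
  assumes g: "integrable lborel g"
    and [measurable]: "Z \<in> borel_measurable M" and Z: "integrable M (\<lambda>x. (cmod (Z x))\<^sup>2)"
  shows "integrable (lborel \<Otimes>\<^sub>M M) (\<lambda>(t, x). of_real (\<Phi> t x) * g t * Z x)"
proof -
  interpret P: pair_sigma_finite lborel M by (rule pair_sigma_finite_lborel)
  note [measurable] = borel_measurable_integrable[OF g]
  show ?thesis
  proof (rule P.Fubini_integrable)
    show "(\<lambda>(t, x). of_real (\<Phi> t x) * g t * Z x) \<in> borel_measurable (lborel \<Otimes>\<^sub>M M)" by measurable
    let ?B = "(K + expectation (\<lambda>x. (cmod (Z x))\<^sup>2)) / 2"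
    have eq: "(\<lambda>x. cmod (of_real (\<Phi> t x) * g t * Z x)) = (\<lambda>x. cmod (g t) * cmod (of_real (\<Phi> t x) * Z x))" for t
      by (simp add: norm_mult mult_ac)
    show "integrable lborel (\<lambda>t. LINT x|M. cmod (case (t, x) of (t, x) \<Rightarrow> of_real (\<Phi> t x) * g t * Z x))"
    proof (rule Bochner_Integration.integrable_bound)
      show "integrable lborel (\<lambda>t. cmod (g t) * ?B)" using g by simp
      show "AE t in lborel. norm (LINT x|M. cmod (case (t, x) of (t, x) \<Rightarrow> of_real (\<Phi> t x) * g t * Z x))
          \<le> norm (cmod (g t) * ?B)"
      proof (rule AE_I2)
        fix t
        have "0 \<le> expectation (\<lambda>x. cmod (of_real (\<Phi> t x) * Z x))" by simp
        then have "0 \<le> ?B" using integrable_process_mult(2)[OF assms(2,3), of t] by linarith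
        then show "norm (LINT x|M. cmod (case (t, x) of (t, x) \<Rightarrow> of_real (\<Phi> t x) * g t * Z x))
          \<le> norm (cmod (g t) * ?B)"
          using mult_left_mono[OF integrable_process_mult(2)[OF assms(2,3), of t], of "cmod (g t)"]
          unfolding prod.case eq integral_mult_right_zero by (simp add: abs_mult)
      qed
    qed measurable
    show "AE t in lborel. integrable M (\<lambda>x. case (t, x) of (t, x) \<Rightarrow> of_real (\<Phi> t x) * g t * Z x)"
    proof (rule AE_I2)
      fix t
      have "integrable M (\<lambda>x. g t * (of_real (\<Phi> t x) * Z x))"
        using integrable_process_mult(1)[OF assms(2,3), of t] by (rule integrable_mult_right)
      then show "integrable M (\<lambda>x. case (t, x) of (t, x) \<Rightarrow> of_real (\<Phi> t x) * g t * Z x)"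
        by (simp add: mult_ac)
    qed
  qed
qed

lemma AE_integrable_path:
  fixes g :: "real \<Rightarrow> complex"
  assumes g: "integrable lborel g"
  shows "AE x in M. integrable lborel (\<lambda>t. of_real (\<Phi> t x) * g t)"
proof -
  interpret P: pair_sigma_finite lborel M by (rule pair_sigma_finite_lborel)
  interpret Q: pair_sigma_finite M lborel ..
  have "integrable (lborel \<Otimes>\<^sub>M M) (\<lambda>(t, x). of_real (\<Phi> t x) * g t)"
    using integrable_process_product[OF g, of "\<lambda>_. 1"] by simp
  from Q.AE_integrable_fst'[OF P.integrable_product_swap[OF this]] show ?thesis by simp
qed

lemma expectation_path_integral_mult:
  assumes g: "integrable lborel g"
    and [measurable]: "Z \<in> borel_measurable M" and Z: "integrable M (\<lambda>x. (cmod (Z x))\<^sup>2)"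
  shows "expectation (\<lambda>x. path_integral g x * Z x)
      = (CLINT t|lborel. g t * expectation (\<lambda>x. of_real (\<Phi> t x) * Z x))"
    and "integrable lborel (\<lambda>t. g t * expectation (\<lambda>x. of_real (\<Phi> t x) * Z x))"
proof -
  interpret P: pair_sigma_finite lborel M by (rule pair_sigma_finite_lborel)
  note [measurable] = borel_measurable_integrable[OF g]
  have eq: "expectation (\<lambda>x. of_real (\<Phi> t x) * g t * Z x) = g t * expectation (\<lambda>x. of_real (\<Phi> t x) * Z x)" for t
    by (simp add: mult_ac flip: integral_mult_right_zero)
  have "expectation (\<lambda>x. path_integral g x * Z x) = expectation (\<lambda>x. CLINT t|lborel. of_real (\<Phi> t x) * g t * Z x)"
    by (simp add: path_integral_def)
  also have "\<dots> = (CLINT t|lborel. expectation (\<lambda>x. of_real (\<Phi> t x) * g t * Z x))"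
    using integrable_process_product[OF assms] by (rule P.Fubini_integral)
  finally show "expectation (\<lambda>x. path_integral g x * Z x)
      = (CLINT t|lborel. g t * expectation (\<lambda>x. of_real (\<Phi> t x) * Z x))"
    unfolding eq .
  show "integrable lborel (\<lambda>t. g t * expectation (\<lambda>x. of_real (\<Phi> t x) * Z x))"
    using P.integrable_fst[OF integrable_process_product[OF assms]] unfolding eq .
qed

text \<open>The inequality \<open>\<bar>path_integral g x\<bar>\<^sup>2 \<le> c * \<integral> (\<Phi> t x)\<^sup>2 * cmod (g t) dt\<close>, with
\<open>c\<close> the \<open>L\<^sup>1\<close>-norm of \<open>g\<close>, is Cauchy-Schwarz for the splitting
\<open>cmod (g t) = sqrt (cmod (g t)) * sqrt (cmod (g t))\<close>; its right-hand side has mean at most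
\<open>c\<^sup>2 * K\<close>.\<close>

lemma square_integrable_path_integral:
  assumes g: "integrable lborel g"
  shows "integrable M (\<lambda>x. (cmod (path_integral g x))\<^sup>2)"
proof -
  interpret P: pair_sigma_finite lborel M by (rule pair_sigma_finite_lborel)
  note [measurable] = borel_measurable_integrable[OF g]
  have K: "0 \<le> K" by (rule order_trans[OF _ second_moment_le[of 0]]) simp
  define c where "c = (LINT t|lborel. cmod (g t))"
  have c: "(\<integral>\<^sup>+t. cmod (g t) \<partial>lborel) = ennreal c" "0 \<le> c"
    using g by (simp_all add: c_def nn_integral_eq_integral)
  have "(\<integral>\<^sup>+x. (\<integral>\<^sup>+t. ennreal ((\<Phi> t x)\<^sup>2 * cmod (g t)) \<partial>lborel) \<partial>M)
      = (\<integral>\<^sup>+t. (\<integral>\<^sup>+x. ennreal ((\<Phi> t x)\<^sup>2 * cmod (g t)) \<partial>M) \<partial>lborel)"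
    by (rule P.Fubini') measurable
  also have "\<dots> \<le> (\<integral>\<^sup>+t. ennreal K * ennreal (cmod (g t)) \<partial>lborel)"
  proof (rule nn_integral_mono)
    fix t
    have "(\<integral>\<^sup>+x. ennreal ((\<Phi> t x)\<^sup>2 * cmod (g t)) \<partial>M) = ennreal (expectation (\<lambda>x. (\<Phi> t x)\<^sup>2) * cmod (g t))"
      using square_integrable_process[of t] by (subst nn_integral_eq_integral) auto
    also have "\<dots> \<le> ennreal (K * cmod (g t))"
      using second_moment_le[of t] by (intro ennreal_leI mult_right_mono) auto
    finally show "(\<integral>\<^sup>+x. ennreal ((\<Phi> t x)\<^sup>2 * cmod (g t)) \<partial>M) \<le> ennreal K * ennreal (cmod (g t))"
      using K by (simp add: ennreal_mult)
  qed
  also have "\<dots> = ennreal (K * c)" using K by (simp add: nn_integral_cmult c ennreal_mult)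
  finally have swap: "(\<integral>\<^sup>+x. (\<integral>\<^sup>+t. ennreal ((\<Phi> t x)\<^sup>2 * cmod (g t)) \<partial>lborel) \<partial>M) \<le> ennreal (K * c)" .
  have "(\<integral>\<^sup>+x. ennreal ((cmod (path_integral g x))\<^sup>2) \<partial>M)
      \<le> (\<integral>\<^sup>+x. (\<integral>\<^sup>+t. ennreal ((\<Phi> t x)\<^sup>2 * cmod (g t)) \<partial>lborel) * c \<partial>M)"
  proof (rule nn_integral_mono_AE, use AE_integrable_path[OF g] AE_space in eventually_elim)
    fix x assume i: "integrable lborel (\<lambda>t. of_real (\<Phi> t x) * g t)" and [measurable]: "x \<in> space M"
    have "ennreal ((cmod (path_integral g x))\<^sup>2) = (ennreal (cmod (path_integral g x)))\<^sup>2"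
      by (simp add: ennreal_power)
    also have "\<dots> \<le> (\<integral>\<^sup>+t. ennreal (\<bar>\<Phi> t x\<bar> * sqrt (cmod (g t))) * ennreal (sqrt (cmod (g t))) \<partial>lborel)\<^sup>2"
      using integral_norm_bound_ennreal[OF i]
      by (intro power_mono) (auto simp: path_integral_def norm_mult mult.assoc simp flip: ennreal_mult)
    also have "\<dots> \<le> (\<integral>\<^sup>+t. (ennreal (\<bar>\<Phi> t x\<bar> * sqrt (cmod (g t))))\<^sup>2 \<partial>lborel)
        * (\<integral>\<^sup>+t. (ennreal (sqrt (cmod (g t))))\<^sup>2 \<partial>lborel)"
      by (rule Cauchy_Schwarz_nn_integral) measurable
    also have "\<dots> = (\<integral>\<^sup>+t. ennreal ((\<Phi> t x)\<^sup>2 * cmod (g t)) \<partial>lborel) * c"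
      by (simp add: ennreal_power power_mult_distrib c)
    finally show "ennreal ((cmod (path_integral g x))\<^sup>2) \<le> (\<integral>\<^sup>+t. ennreal ((\<Phi> t x)\<^sup>2 * cmod (g t)) \<partial>lborel) * c" .
  qed
  also have "\<dots> = (\<integral>\<^sup>+x. (\<integral>\<^sup>+t. ennreal ((\<Phi> t x)\<^sup>2 * cmod (g t)) \<partial>lborel) \<partial>M) * c"
    by (rule nn_integral_multc) measurable
  also have "\<dots> \<le> ennreal (K * c) * c" using swap by (rule mult_right_mono) simp
  also have "\<dots> < \<infinity>" by (simp add: ennreal_mult_less_top)
  finally have "(\<integral>\<^sup>+x. ennreal ((cmod (path_integral g x))\<^sup>2) \<partial>M) < \<infinity>" .
  then show ?thesis by (intro integrableI_bounded) auto
qed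

text \<open>The hypothesis \<open>weak\<close> says that \<open>Y\<close> is the integral \<open>\<integral> g t * \<Phi> t dt\<close> in the
mean-square sense. As \<open>g\<close> is merely integrable, the approximating sums come from Maurey's greedy averaging
instead of a partition of the time axis. With \<open>c\<close> the \<open>L\<^sup>1\<close>-norm of \<open>g\<close>, the variable \<open>Y\<close> is
the barycentre of the variables \<open>c * sgn (g t) * \<Phi> t\<close> under the probability density
\<open>\<bar>g t\<bar> / c\<close>. Given the average \<open>S\<close> of 0 and the terms chosen so far, some \<open>t\<close> makes the
inner product of \<open>Y - S\<close> with \<open>Y - c * sgn (g t) * \<Phi> t\<close> nonpositive, since its mean over
\<open>t\<close> is zero. Adding this term to the average with weight \<open>p = 1 / (n + 2)\<close> therefore turns the
mean square error \<open>e\<close> into at most \<open>(1 - p)\<^sup>2 * e + p\<^sup>2 * V\<close>, where \<open>V\<close> bounds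
the mean square of \<open>Y - c * sgn (g t) * \<Phi> t\<close> for all \<open>t\<close>; this keeps it below
\<open>V / (n + 1)\<close> after \<open>n\<close> steps.\<close>

lemma real_integral_approx_by_linear_combinations:
  fixes g :: "real \<Rightarrow> real" and Y :: "'a \<Rightarrow> real"
  assumes g: "integrable lborel g"
    and [measurable]: "Y \<in> borel_measurable M" and Y: "integrable M (\<lambda>x. (Y x)\<^sup>2)"
    and weak: "\<And>Z. Z \<in> borel_measurable M \<Longrightarrow> integrable M (\<lambda>x. (Z x)\<^sup>2) \<Longrightarrow>
      integrable lborel (\<lambda>t. g t * expectation (\<lambda>x. \<Phi> t x * Z x)) \<and>
      expectation (\<lambda>x. Y x * Z x) = (LINT t|lborel. g t * expectation (\<lambda>x. \<Phi> t x * Z x))"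
  shows "\<exists>V. \<forall>n. \<exists>T a. finite T \<and> expectation (\<lambda>x. (Y x - (\<Sum>t\<in>T. a t * \<Phi> t x))\<^sup>2) \<le> V / real (Suc n)"
proof -
  have \<Phi>2: "integrable M (\<lambda>x. \<Phi> t x * \<Phi> t x)" for t
    using square_integrable_process by (simp add: power2_eq_square)
  have iC: "integrable M (\<lambda>x. U x * V x)"
    if "U \<in> borel_measurable M" "V \<in> borel_measurable M" "integrable M (\<lambda>x. (U x)\<^sup>2)" "integrable M (\<lambda>x. (V x)\<^sup>2)"
    for U V :: "'a \<Rightarrow> real"
    using integrable_mult_of_square_integrable[of U M V] that by simp
  define c where "c = (LINT t|lborel. \<bar>g t\<bar>)"
  have c0: "0 \<le> c" by (simp add: c_def)
  define V where "V = 2 * expectation (\<lambda>x. (Y x)\<^sup>2) + 2 * c\<^sup>2 * K"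
  have K: "0 \<le> K" by (rule order_trans[OF _ second_moment_le[of 0]]) simp
  then have V0: "0 \<le> V" by (simp add: V_def)
  \<comment> \<open>If every \<open>t\<close> failed, the nonnegative function \<open>?f\<close> below, whose integral is 0, could vanish
    only where \<open>g\<close> does; then \<open>g\<close> would be 0 almost everywhere and both sides equal.\<close>
  have pick: "\<exists>t. expectation (\<lambda>x. Y x * Z x) \<le> c * sgn (g t) * expectation (\<lambda>x. \<Phi> t x * Z x)"
    if Z: "Z \<in> borel_measurable M" "integrable M (\<lambda>x. (Z x)\<^sup>2)" for Z
  proof (rule ccontr)
    let ?E = "expectation (\<lambda>x. Y x * Z x)" and ?h = "\<lambda>t. expectation (\<lambda>x. \<Phi> t x * Z x)"
    assume "\<not> ?thesis"
    then have lt: "c * sgn (g t) * ?h t < ?E" for t by (simp add: not_le)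
    let ?f = "\<lambda>t. \<bar>g t\<bar> * ?E - c * (g t * ?h t)"
    have f: "?f t = \<bar>g t\<bar> * (?E - c * sgn (g t) * ?h t)" for t
      by (simp add: algebra_simps abs_if sgn_if)
    have fi: "integrable lborel ?f" using g weak[OF Z] by auto
    have "(LINT t|lborel. ?f t) = 0"
      using g weak[OF Z] by (simp add: c_def)
    moreover have "0 \<le> ?f t" for t unfolding f using lt[of t] by (intro mult_nonneg_nonneg) auto
    ultimately have "AE t in lborel. ?f t = 0"
      using fi integral_nonneg_eq_0_iff_AE[of lborel ?f] by simp
    moreover have "?f t = 0 \<longleftrightarrow> g t = 0" for t unfolding f using lt[of t] by auto
    ultimately have g0: "AE t in lborel. g t = 0" by simp
    have "c = 0"
      unfolding c_def using g0 by (intro integral_eq_zero_AE) auto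
    moreover have "?E = 0"
      using weak[OF Z] g0 by (auto intro!: integral_eq_zero_AE)
    ultimately show False using lt[of 0] by simp
  qed
  have "\<exists>T a. finite T \<and> expectation (\<lambda>x. (Y x - (\<Sum>t\<in>T. a t * \<Phi> t x))\<^sup>2) \<le> V / real (Suc n)" for n
  proof (induction n)
    case 0
    have "expectation (\<lambda>x. (Y x)\<^sup>2) \<le> V"
      using K by (simp add: V_def integral_nonneg_AE)
    then show ?case by (intro exI[of _ "{}"]) simp
  next
    case (Suc n)
    then obtain T a where T: "finite T" and e: "expectation (\<lambda>x. (Y x - (\<Sum>t\<in>T. a t * \<Phi> t x))\<^sup>2) \<le> V / real (Suc n)"
      by blast
    define S where "S x = (\<Sum>t\<in>T. a t * \<Phi> t x)" for x
    have [measurable]: "S \<in> borel_measurable M" unfolding S_def by measurable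
    have S2: "integrable M (\<lambda>x. (S x)\<^sup>2)"
      unfolding S_def power2_eq_square sum_product
      by (intro Bochner_Integration.integrable_sum iC)
         (simp_all add: power_mult_distrib square_integrable_process)
    let ?Z = "\<lambda>x. Y x - S x"
    have Z2: "integrable M (\<lambda>x. (?Z x)\<^sup>2)"
      using Y S2 iC[of Y S] by (simp add: power2_diff mult.assoc)
    obtain t where t: "expectation (\<lambda>x. Y x * ?Z x) \<le> c * sgn (g t) * expectation (\<lambda>x. \<Phi> t x * ?Z x)"
      using pick[of ?Z] Z2 by auto
    define X where "X x = c * sgn (g t) * \<Phi> t x" for x
    have [measurable]: "X \<in> borel_measurable M" unfolding X_def by measurable
    have X2: "integrable M (\<lambda>x. (X x)\<^sup>2)"
      unfolding X_def using square_integrable_process by (simp add: power_mult_distrib)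
    have sg: "(sgn (g t))\<^sup>2 \<le> 1" by (simp add: sgn_if)
    have EX2: "expectation (\<lambda>x. (X x)\<^sup>2) \<le> c\<^sup>2 * K"
    proof -
      have "expectation (\<lambda>x. (X x)\<^sup>2) = c\<^sup>2 * ((sgn (g t))\<^sup>2 * expectation (\<lambda>x. (\<Phi> t x)\<^sup>2))"
        by (simp add: X_def power_mult_distrib)
      also have "\<dots> \<le> c\<^sup>2 * (1 * K)"
        using sg second_moment_le[of t] by (intro mult_left_mono mult_mono) auto
      finally show ?thesis by simp
    qed
    let ?D = "\<lambda>x. Y x - X x"
    have D2: "integrable M (\<lambda>x. (?D x)\<^sup>2)"
      using Y X2 iC[of Y X] by (simp add: power2_diff mult.assoc)
    have ED2: "expectation (\<lambda>x. (?D x)\<^sup>2) \<le> V"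
    proof -
      have "expectation (\<lambda>x. (?D x)\<^sup>2) \<le> expectation (\<lambda>x. 2 * (Y x)\<^sup>2 + 2 * (X x)\<^sup>2)"
      proof (rule integral_mono)
        fix x show "(?D x)\<^sup>2 \<le> 2 * (Y x)\<^sup>2 + 2 * (X x)\<^sup>2"
          using zero_le_power2[of "Y x + X x"] by (simp add: power2_eq_square algebra_simps)
      qed (use Y X2 D2 in auto)
      also have "\<dots> \<le> V" using Y X2 EX2 by (simp add: V_def)
      finally show ?thesis .
    qed
    have iZ: "integrable M (\<lambda>x. Y x * ?Z x)" "integrable M (\<lambda>x. X x * ?Z x)" "integrable M (\<lambda>x. ?Z x * ?D x)"
      using Y X2 Z2 D2 by (auto intro!: iC)
    have cross: "expectation (\<lambda>x. ?Z x * ?D x) \<le> 0"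
    proof -
      have "expectation (\<lambda>x. ?Z x * ?D x) = expectation (\<lambda>x. Y x * ?Z x - X x * ?Z x)"
        by (simp add: algebra_simps)
      also have "\<dots> = expectation (\<lambda>x. Y x * ?Z x) - expectation (\<lambda>x. X x * ?Z x)"
        using iZ by (intro Bochner_Integration.integral_diff)
      also have "expectation (\<lambda>x. X x * ?Z x) = c * sgn (g t) * expectation (\<lambda>x. \<Phi> t x * ?Z x)"
        by (simp add: X_def mult.assoc)
      finally show ?thesis using t by simp
    qed
    define p where "p = 1 / (real n + 2)"
    have p: "0 < p" "p < 1" by (auto simp: p_def)
    have "expectation (\<lambda>x. (Y x - ((1 - p) * S x + p * X x))\<^sup>2)
        = expectation (\<lambda>x. (1 - p)\<^sup>2 * (?Z x)\<^sup>2 + 2 * p * (1 - p) * (?Z x * ?D x) + p\<^sup>2 * (?D x)\<^sup>2)"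
      by (intro Bochner_Integration.integral_cong refl) algebra
    also have "\<dots> = (1 - p)\<^sup>2 * expectation (\<lambda>x. (?Z x)\<^sup>2) + 2 * p * (1 - p) * expectation (\<lambda>x. ?Z x * ?D x)
        + p\<^sup>2 * expectation (\<lambda>x. (?D x)\<^sup>2)"
      using Z2 iZ(3) D2 by (simp del: right_diff_distrib left_diff_distrib)
    also have "\<dots> \<le> (1 - p)\<^sup>2 * (V / real (Suc n)) + 0 + p\<^sup>2 * V"
      using e cross ED2 p by (intro add_mono mult_left_mono mult_nonneg_nonpos) (auto simp: S_def)
    also have "\<dots> = V / real (Suc (Suc n))"
    proof -
      have p': "1 - p = real (Suc n) * p" by (simp add: p_def field_simps)
      have "(1 - p)\<^sup>2 * (V / real (Suc n)) + 0 + p\<^sup>2 * V = V * p * (p * (real n + 2))"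
        unfolding p' by (simp add: power2_eq_square divide_simps del: of_nat_Suc) (simp add: algebra_simps)
      then show ?thesis by (simp add: p_def)
    qed
    finally have fin: "expectation (\<lambda>x. (Y x - ((1 - p) * S x + p * X x))\<^sup>2) \<le> V / real (Suc (Suc n))" .
    define b where "b u = (1 - p) * (if u \<in> T then a u else 0) + (if u = t then p * (c * sgn (g t)) else 0)" for u
    have "(\<Sum>u\<in>insert t T. b u * \<Phi> u x) = (1 - p) * S x + p * X x" for x
    proof -
      have "(\<Sum>u\<in>insert t T. b u * \<Phi> u x) = (\<Sum>u\<in>insert t T. if u \<in> T then (1 - p) * (a u * \<Phi> u x) else 0)
          + (\<Sum>u\<in>insert t T. if u = t then p * (c * sgn (g t)) * \<Phi> u x else 0)"
        by (subst sum.distrib[symmetric]) (auto intro!: sum.cong simp: b_def algebra_simps)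
      also have "(\<Sum>u\<in>insert t T. if u \<in> T then (1 - p) * (a u * \<Phi> u x) else 0) = (1 - p) * S x"
      proof -
        have "(\<Sum>u\<in>insert t T. if u \<in> T then (1 - p) * (a u * \<Phi> u x) else 0) = (\<Sum>u\<in>T. (1 - p) * (a u * \<Phi> u x))"
          using T by (intro sum.mono_neutral_cong_right) auto
        then show ?thesis by (simp add: S_def sum_distrib_left)
      qed
      also have "(\<Sum>u\<in>insert t T. if u = t then p * (c * sgn (g t)) * \<Phi> u x else 0) = p * X x"
        using T by (simp add: X_def mult.assoc)
      finally show ?thesis .
    qed
    then show ?case using fin T by (intro exI[of _ "insert t T"] exI[of _ b]) simp
  qed
  then show ?thesis by blast
qed

end

text \<open>The real part of a path integral is the integral of \<open>\<Phi>\<close> against the real function \<open>Re g\<close>,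
hence a mean-square limit of finite linear combinations of a Gaussian process.\<close>

lemma (in bounded_second_order_process) gaussian_char_Re_path_integral:
  fixes g :: "real \<Rightarrow> complex"
  assumes g: "integrable lborel g" and gauss: "gaussian_process M \<Phi>"
  defines "Y \<equiv> \<lambda>x. Re (path_integral g x)"
  shows "expectation (\<lambda>x. iexp (Y x))
      = iexp (expectation Y) * exp (- of_real (expectation (\<lambda>x. (Y x)\<^sup>2) - (expectation Y)\<^sup>2) / 2)"
proof -
  note [measurable] = borel_measurable_integrable[OF g]
  have [measurable]: "Y \<in> borel_measurable M" unfolding Y_def by measurable
  note W2 = square_integrable_path_integral[OF g]
  have Y2: "integrable M (\<lambda>x. (Y x)\<^sup>2)"
    by (rule Bochner_Integration.integrable_bound[OF W2]) (auto simp: Y_def cmod_power2)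
  have weak: "integrable lborel (\<lambda>t. Re (g t) * expectation (\<lambda>x. \<Phi> t x * Z x)) \<and>
      expectation (\<lambda>x. Y x * Z x) = (LINT t|lborel. Re (g t) * expectation (\<lambda>x. \<Phi> t x * Z x))"
    if [measurable]: "Z \<in> borel_measurable M" and Z2: "integrable M (\<lambda>x. (Z x)\<^sup>2)" for Z
  proof -
    have Z: "(\<lambda>x. complex_of_real (Z x)) \<in> borel_measurable M"
        "integrable M (\<lambda>x. (cmod (complex_of_real (Z x)))\<^sup>2)"
      using Z2 by auto
    have iWZ: "integrable M (\<lambda>x. path_integral g x * of_real (Z x))"
      using W2 Z by (intro integrable_mult_of_square_integrable) auto
    note e = expectation_path_integral_mult[OF g Z]
    have ez: "expectation (\<lambda>x. of_real (\<Phi> t x) * complex_of_real (Z x)) = of_real (expectation (\<lambda>x. \<Phi> t x * Z x))" for t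
      by (simp flip: of_real_mult)
    have "integrable lborel (\<lambda>t. Re (g t * of_real (expectation (\<lambda>x. \<Phi> t x * Z x))))"
      using e(2) unfolding ez by (rule integrable_Re)
    moreover have "expectation (\<lambda>x. Y x * Z x) = Re (expectation (\<lambda>x. path_integral g x * of_real (Z x)))"
      using iWZ by (simp add: Y_def flip: integral_Re)
    moreover have "Re (expectation (\<lambda>x. path_integral g x * of_real (Z x)))
        = (LINT t|lborel. Re (g t) * expectation (\<lambda>x. \<Phi> t x * Z x))"
      unfolding e(1) using integral_Re[OF e(2)] unfolding ez by simp
    ultimately show ?thesis by simp
  qed
  obtain V where "\<forall>n. \<exists>T a. finite T \<and> expectation (\<lambda>x. (Y x - (\<Sum>t\<in>T. a t * \<Phi> t x))\<^sup>2) \<le> V / real (Suc n)"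
    using real_integral_approx_by_linear_combinations[OF integrable_Re[OF g] \<open>Y \<in> borel_measurable M\<close> Y2 weak] by blast
  from choice[OF this] obtain T where
    "\<forall>n. \<exists>a. finite (T n) \<and> expectation (\<lambda>x. (Y x - (\<Sum>t\<in>T n. a t * \<Phi> t x))\<^sup>2) \<le> V / real (Suc n)" ..
  from choice[OF this] obtain a where T: "\<And>n. finite (T n)"
    and V: "\<And>n. expectation (\<lambda>x. (Y x - (\<Sum>t\<in>T n. a n t * \<Phi> t x))\<^sup>2) \<le> V / real (Suc n)"
    by blast
  show "expectation (\<lambda>x. iexp (Y x))
      = iexp (expectation Y) * exp (- of_real (expectation (\<lambda>x. (Y x)\<^sup>2) - (expectation Y)\<^sup>2) / 2)"
  proof (rule L2_limit_of_gaussian)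
    show "gaussian_rv M (\<lambda>x. \<Sum>t\<in>T n. a n t * \<Phi> t x)" for n
      using gauss T unfolding gaussian_process_def by blast
    show "(\<lambda>n. expectation (\<lambda>x. (Y x - (\<Sum>t\<in>T n. a n t * \<Phi> t x))\<^sup>2)) \<longlonglongrightarrow> 0"
    proof (rule tendsto_sandwich[of "\<lambda>_. 0" _ _ "\<lambda>n. V / real (Suc n)"])
      show "(\<lambda>n. V / real (Suc n)) \<longlonglongrightarrow> 0"
        using tendsto_mult[OF tendsto_const[of V] LIMSEQ_inverse_real_of_nat] by (simp add: divide_inverse)
    qed (use V in auto)
  qed (use Y2 in auto)
qed

section \<open>Path integrals without nonpositive frequencies\<close>

lemma (in pair_sigma_finite) integral_kernel_swap:
  fixes k :: "'a \<Rightarrow> complex" and u :: "'a \<Rightarrow> 'b \<Rightarrow> complex"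
  assumes k: "integrable M1 k" and "finite_measure M2"
    and [measurable]: "case_prod u \<in> borel_measurable (M1 \<Otimes>\<^sub>M M2)"
    and u: "\<And>s l. cmod (u s l) \<le> B"
  shows "(CLINT s|M1. k s * (CLINT l|M2. u s l)) = (CLINT l|M2. CLINT s|M1. k s * u s l)"
proof -
  interpret F: finite_measure M2 by fact
  note [measurable] = borel_measurable_integrable[OF k]
  have B: "0 \<le> B" using norm_ge_zero u order_trans by blast
  have iu: "integrable M2 (u s)" if "s \<in> space M1" for s
  proof (rule F.integrable_const_bound[where B=B])
    have "(\<lambda>l. case_prod u (s, l)) \<in> borel_measurable M2" using that by measurable
    then show "u s \<in> borel_measurable M2" by simp
  qed (use u in auto)
  have "integrable (M1 \<Otimes>\<^sub>M M2) (\<lambda>(s, l). k s * u s l)"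
  proof (rule Fubini_integrable)
    show "integrable M1 (\<lambda>s. LINT l|M2. cmod (case (s, l) of (s, l) \<Rightarrow> k s * u s l))"
    proof (rule Bochner_Integration.integrable_bound)
      show "integrable M1 (\<lambda>s. cmod (k s) * (B * measure M2 (space M2)))" using k by simp
      show "AE s in M1. norm (LINT l|M2. cmod (case (s, l) of (s, l) \<Rightarrow> k s * u s l))
          \<le> norm (cmod (k s) * (B * measure M2 (space M2)))"
      proof (rule AE_I2)
        fix s assume s: "s \<in> space M1"
        have "(LINT l|M2. cmod (u s l)) \<le> (LINT l|M2. B)"
          using iu[OF s] u by (intro integral_mono) auto
        then have "cmod (k s) * (LINT l|M2. cmod (u s l)) \<le> cmod (k s) * (B * measure M2 (space M2))"
          by (intro mult_left_mono) (auto simp: mult.commute)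
        then show "norm (LINT l|M2. cmod (case (s, l) of (s, l) \<Rightarrow> k s * u s l))
          \<le> norm (cmod (k s) * (B * measure M2 (space M2)))"
          using B by (simp add: norm_mult abs_mult)
      qed
    qed measurable
    show "AE s in M1. integrable M2 (\<lambda>l. case (s, l) of (s, l) \<Rightarrow> k s * u s l)"
      using iu by (intro AE_I2) simp
  qed measurable
  from Fubini_integral[OF this] show ?thesis by simp
qed

lemma integral_mult_iexp_bound:
  assumes "integrable lborel k"
  shows "cmod (CLINT s|lborel. k s * iexp (l * s)) \<le> (LINT s|lborel. cmod (k s))"
  using Bochner_Integration.integral_norm_bound[of lborel "\<lambda>s. k s * iexp (l * s)"]
  by (simp add: norm_mult)

text \<open>Inserting the spectral representation \<open>C (s - t) = \<integral> iexp (l * s) * iexp (- l * t) F(dl)\<close>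
and writing \<open>H l = \<integral> k s * iexp (l * s) ds\<close>, the iterated integral becomes
\<open>\<integral> H l * H (- l) F(dl)\<close>. One of \<open>l\<close> and \<open>- l\<close> is at most 0, so one factor
vanishes; this is the point where analyticity of the wavelet enters.\<close>

lemma iterated_integral_stationary_eq_0:
  fixes k :: "real \<Rightarrow> complex"
  assumes k: "integrable lborel k" and spec: "spectral_measure_of F C"
    and van: "\<And>l. l \<le> 0 \<Longrightarrow> (CLINT s|lborel. k s * iexp (l * s)) = 0"
  shows "(CLINT t|lborel. k t * (CLINT s|lborel. k s * of_real (C (s - t)))) = 0"
proof -
  note [measurable] = borel_measurable_integrable[OF k]
  have [measurable_cong]: "sets F = sets borel" using spec by (simp add: spectral_measure_of_def)
  have sp: "space F = UNIV" using sets_eq_imp_space_eq[OF \<open>sets F = sets borel\<close>] by simp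
  interpret F: finite_measure F
    using spec sp by (intro finite_measureI) (simp add: spectral_measure_of_def)
  interpret P: pair_sigma_finite lborel F ..
  define H where "H l = (CLINT s|lborel. k s * iexp (l * s))" for l
  have [measurable]: "H \<in> borel_measurable borel" unfolding H_def by measurable
  have Hb: "cmod (H l) \<le> (LINT s|lborel. cmod (k s))" for l
    unfolding H_def by (rule integral_mult_iexp_bound[OF k])
  have "(CLINT s|lborel. k s * of_real (C (s - t))) = (CLINT l|F. iexp (- l * t) * H l)" for t
  proof -
    have "(CLINT s|lborel. k s * of_real (C (s - t))) = (CLINT s|lborel. k s * (CLINT l|F. iexp (l * (s - t))))"
      using spec by (simp add: spectral_measure_of_def)
    also have "\<dots> = (CLINT l|F. CLINT s|lborel. k s * iexp (l * (s - t)))"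
      by (rule P.integral_kernel_swap[OF k F.finite_measure_axioms, where B=1]) auto
    also have "\<dots> = (CLINT l|F. CLINT s|lborel. iexp (- l * t) * (k s * iexp (l * s)))"
      by (intro Bochner_Integration.integral_cong refl) (simp add: algebra_simps flip: exp_add)
    finally show ?thesis by (simp add: H_def)
  qed
  then have "(CLINT t|lborel. k t * (CLINT s|lborel. k s * of_real (C (s - t))))
      = (CLINT t|lborel. k t * (CLINT l|F. iexp (- l * t) * H l))" by simp
  also have "\<dots> = (CLINT l|F. CLINT t|lborel. k t * (iexp (- l * t) * H l))"
    using Hb by (intro P.integral_kernel_swap[OF k F.finite_measure_axioms, where B="LINT s|lborel. cmod (k s)"])
       (auto simp: norm_mult)
  also have "\<dots> = (CLINT l|F. H (- l) * H l)"
    by (simp add: H_def mult.assoc flip: integral_mult_left_zero)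
  also have "\<dots> = (CLINT l|F. 0)"
  proof (intro Bochner_Integration.integral_cong refl)
    fix l show "H (- l) * H l = 0" using van[of l] van[of "- l"] by (cases "l \<le> 0") (auto simp: H_def)
  qed
  finally show ?thesis by simp
qed

text \<open>The constant mean contributes only through \<open>\<integral> k s ds\<close>, which is the case \<open>l = 0\<close> of the
assumption \<open>van\<close>. The second conclusion concerns the square, not the squared modulus: it makes the complex
variable \<open>path_integral k\<close> circularly symmetric.\<close>

lemma (in bounded_second_order_process) analytic_path_integral_moments:
  fixes k :: "real \<Rightarrow> complex"
  assumes k: "integrable lborel k"
    and stat: "stationary_with_covariance M \<Phi> C" and spec: "spectral_measure_of F C"
    and van: "\<And>l. l \<le> 0 \<Longrightarrow> (CLINT s|lborel. k s * iexp (l * s)) = 0"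
  shows "expectation (path_integral k) = 0" "expectation (\<lambda>x. (path_integral k x)\<^sup>2) = 0"
proof -
  note [measurable] = borel_measurable_integrable[OF k]
  obtain \<mu> where \<mu>: "\<And>t. expectation (\<Phi> t) = \<mu>" and cov: "\<And>s t. covariance M (\<Phi> s) (\<Phi> t) = C (s - t)"
    using stat unfolding stationary_with_covariance_def by blast
  have i1: "integrable M (\<Phi> t)" for t
    by (rule square_integrable_imp_integrable[OF _ square_integrable_process]) simp
  have i2: "integrable M (\<lambda>x. \<Phi> s x * \<Phi> t x)" for s t
    using integrable_mult_of_square_integrable[of "\<Phi> s" M "\<Phi> t"] square_integrable_process by simp
  have EE: "expectation (\<lambda>x. \<Phi> s x * \<Phi> t x) = C (s - t) + \<mu>\<^sup>2" for s t
  proof -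
    have "C (s - t) = expectation (\<lambda>x. (\<Phi> s x - \<mu>) * (\<Phi> t x - \<mu>))"
      using cov[of s t] by (simp add: covariance_def \<mu>)
    also have "\<dots> = expectation (\<lambda>x. \<Phi> s x * \<Phi> t x - \<mu> * \<Phi> s x - \<mu> * \<Phi> t x + \<mu>\<^sup>2)"
      by (simp add: algebra_simps power2_eq_square)
    also have "\<dots> = expectation (\<lambda>x. \<Phi> s x * \<Phi> t x) - \<mu>\<^sup>2"
      using i1 i2 by (simp add: \<mu> prob_space power2_eq_square)
    finally show ?thesis by simp
  qed
  have k0: "(CLINT s|lborel. k s) = 0" using van[of 0] by simp
  have "expectation (path_integral k) = (CLINT t|lborel. k t * of_real \<mu>)"
    using expectation_path_integral_mult(1)[OF k, of "\<lambda>_. 1"] by (simp add: \<mu>)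
  then show "expectation (path_integral k) = 0" using k0 by simp
  have inner: "expectation (\<lambda>x. of_real (\<Phi> t x) * path_integral k x) = (CLINT s|lborel. k s * of_real (C (s - t)))" for t
  proof -
    have \<Phi>: "(\<lambda>x. complex_of_real (\<Phi> t x)) \<in> borel_measurable M" "integrable M (\<lambda>x. (cmod (complex_of_real (\<Phi> t x)))\<^sup>2)"
      using square_integrable_process by auto
    have e: "k s * expectation (\<lambda>x. of_real (\<Phi> s x) * complex_of_real (\<Phi> t x)) = k s * of_real (C (s - t)) + k s * of_real (\<mu>\<^sup>2)" for s
    proof -
      have "expectation (\<lambda>x. of_real (\<Phi> s x) * complex_of_real (\<Phi> t x)) = of_real (C (s - t) + \<mu>\<^sup>2)"
        unfolding EE[symmetric] by (simp flip: of_real_mult)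
      then show ?thesis by (simp add: algebra_simps)
    qed
    have ik: "integrable lborel (\<lambda>s. k s * of_real (\<mu>\<^sup>2))" using k by simp
    have "integrable lborel (\<lambda>s. (k s * of_real (C (s - t)) + k s * of_real (\<mu>\<^sup>2)) - k s * of_real (\<mu>\<^sup>2))"
      using expectation_path_integral_mult(2)[OF k \<Phi>] ik unfolding e by (rule Bochner_Integration.integrable_diff)
    then have iC: "integrable lborel (\<lambda>s. k s * of_real (C (s - t)))" by simp
    have "expectation (\<lambda>x. of_real (\<Phi> t x) * path_integral k x)
        = (CLINT s|lborel. k s * of_real (C (s - t)) + k s * of_real (\<mu>\<^sup>2))"
      using expectation_path_integral_mult(1)[OF k \<Phi>] unfolding e by (simp add: mult.commute)
    then show ?thesis using iC ik k0 by simp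
  qed
  have "expectation (\<lambda>x. path_integral k x * path_integral k x)
      = (CLINT t|lborel. k t * (CLINT s|lborel. k s * of_real (C (s - t))))"
    using expectation_path_integral_mult(1)[OF k _ square_integrable_path_integral[OF k]] by (simp add: inner)
  also have "\<dots> = 0" by (rule iterated_integral_stationary_eq_0[OF k spec van])
  finally show "expectation (\<lambda>x. (path_integral k x)\<^sup>2) = 0" by (simp add: power2_eq_square)
qed

text \<open>Since \<open>(Re z)\<^sup>2 = (\<bar>z\<bar>\<^sup>2 + Re (z\<^sup>2)) / 2\<close> and the square has mean 0, the variance of the
real part is half the mean squared modulus. The characteristic function thus depends on \<open>k\<close> only through a
quantity that does not change when \<open>k\<close> is multiplied by a unit complex number.\<close>

lemma (in bounded_second_order_process) char_Re_analytic_path_integral: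
  fixes k :: "real \<Rightarrow> complex"
  assumes k: "integrable lborel k" and gauss: "gaussian_process M \<Phi>"
    and stat: "stationary_with_covariance M \<Phi> C" and spec: "spectral_measure_of F C"
    and van: "\<And>l. l \<le> 0 \<Longrightarrow> (CLINT s|lborel. k s * iexp (l * s)) = 0"
  shows "expectation (\<lambda>x. iexp (Re (path_integral k x)))
      = exp (- of_real (expectation (\<lambda>x. (cmod (path_integral k x))\<^sup>2)) / 4)"
proof -
  note [measurable] = borel_measurable_integrable[OF k]
  let ?Z = "path_integral k"
  note mom = analytic_path_integral_moments[OF k stat spec van]
  note Z2 = square_integrable_path_integral[OF k]
  have iZ: "integrable M ?Z"
  proof (rule square_integrable_imp_integrable)
    show "integrable M (\<lambda>x. (?Z x)\<^sup>2)"
      by (rule Bochner_Integration.integrable_bound[OF Z2]) (auto simp: norm_power)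
  qed measurable
  have iZZ: "integrable M (\<lambda>x. (?Z x)\<^sup>2)"
    by (rule Bochner_Integration.integrable_bound[OF Z2]) (auto simp: norm_power)
  have m1: "expectation (\<lambda>x. Re (?Z x)) = 0" using integral_Re[OF iZ] mom(1) by simp
  have m2: "expectation (\<lambda>x. (Re (?Z x))\<^sup>2) = expectation (\<lambda>x. (cmod (?Z x))\<^sup>2) / 2"
  proof -
    have "expectation (\<lambda>x. (Re (?Z x))\<^sup>2) = expectation (\<lambda>x. ((cmod (?Z x))\<^sup>2 + Re ((?Z x)\<^sup>2)) / 2)"
      by (intro Bochner_Integration.integral_cong refl) (simp add: cmod_power2 Re_power2)
    also have "\<dots> = (expectation (\<lambda>x. (cmod (?Z x))\<^sup>2) + expectation (\<lambda>x. Re ((?Z x)\<^sup>2))) / 2"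
      using Z2 integrable_Re[OF iZZ] by simp
    finally show ?thesis using integral_Re[OF iZZ] mom(2) by simp
  qed
  show ?thesis
    unfolding gaussian_char_Re_path_integral[OF k gauss] m1 m2 by simp
qed

section \<open>Wavelet coefficients\<close>

definition wavelet_atom :: "(real \<Rightarrow> complex) \<Rightarrow> real \<Rightarrow> real \<Rightarrow> real \<Rightarrow> complex" where
  "wavelet_atom \<psi> t s \<tau> = of_real (1 / sqrt s) * cnj (\<psi> ((\<tau> - t) / s))"

lemma integrable_wavelet_atom:
  assumes "integrable lborel \<psi>" "s > 0"
  shows "integrable lborel (wavelet_atom \<psi> t s)"
proof -
  have "(\<lambda>\<tau>. \<psi> (- t / s + (1 / s) * \<tau>)) = (\<lambda>\<tau>. \<psi> ((\<tau> - t) / s))"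
    by (simp add: diff_divide_distrib)
  then have "integrable lborel (\<lambda>\<tau>. \<psi> ((\<tau> - t) / s))"
    using lborel_integrable_real_affine[OF assms(1), of "1 / s" "- t / s"] assms(2) by simp
  then show ?thesis unfolding wavelet_atom_def by simp
qed

text \<open>Conjugation reflects the frequency axis, and the exponent here has the sign opposite to that in \<open>fourier\<close>;
the two reversals cancel. An atom of an analytic wavelet therefore satisfies the vanishing condition at
\<open>l \<le> 0\<close>.\<close>

lemma fourier_wavelet_atom:
  assumes "s > 0"
  shows "(CLINT \<tau>|lborel. wavelet_atom \<psi> t s \<tau> * iexp (l * \<tau>))
      = of_real (sqrt s) * iexp (l * t) * cnj (fourier \<psi> (s * l))"
proof -
  have "(CLINT \<tau>|lborel. wavelet_atom \<psi> t s \<tau> * iexp (l * \<tau>))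
      = \<bar>s\<bar> *\<^sub>R (CLINT u|lborel. wavelet_atom \<psi> t s (t + s * u) * iexp (l * (t + s * u)))"
    using assms by (intro lborel_integral_real_affine) simp
  also have "(CLINT u|lborel. wavelet_atom \<psi> t s (t + s * u) * iexp (l * (t + s * u)))
      = (CLINT u|lborel. (of_real (1 / sqrt s) * iexp (l * t)) * cnj (exp (- (\<i> * of_real (u * (s * l)))) * \<psi> u))"
    using assms
    by (intro Bochner_Integration.integral_cong refl)
       (simp add: wavelet_atom_def exp_cnj distrib_left exp_add mult_ac)
  also have "\<dots> = (of_real (1 / sqrt s) * iexp (l * t)) * cnj (fourier \<psi> (s * l))"
    by (simp add: fourier_def del: complex_cnj_mult)
  also have "\<bar>s\<bar> *\<^sub>R (of_real (1 / sqrt s) * iexp (l * t) * cnj (fourier \<psi> (s * l)))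
      = of_real (s / sqrt s) * iexp (l * t) * cnj (fourier \<psi> (s * l))"
    using assms by (simp add: scaleR_conv_of_real)
  finally show ?thesis using assms by (simp add: real_div_sqrt)
qed

text \<open>By uniqueness of characteristic functions \<open>X\<close> is distributed as \<open>\<sigma>\<close> times a standard normal
variable, which has no atoms.\<close>

lemma AE_nonzero_if_normal_char:
  assumes "prob_space M" and [measurable]: "X \<in> borel_measurable M" and "0 < \<sigma>"
    and char: "\<And>u. (CLINT x|M. iexp (u * X x)) = of_real (exp (- (u * \<sigma>)\<^sup>2 / 2))"
  shows "AE x in M. X x \<noteq> (0 :: real)"
proof -
  interpret prob_space M by fact
  interpret N: real_distribution std_normal_distribution by (rule real_dist_normal_dist)
  have "distr M borel X = distr std_normal_distribution borel (\<lambda>z. \<sigma> * z)"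
  proof (rule Levy_uniqueness)
    show "char (distr M borel X) = char (distr std_normal_distribution borel (\<lambda>z. \<sigma> * z))"
    proof
      fix u
      have "char (distr std_normal_distribution borel (\<lambda>z. \<sigma> * z)) u = char std_normal_distribution (u * \<sigma>)"
        unfolding char_def by (subst integral_distr) (auto simp: mult.assoc)
      also have "\<dots> = (CLINT x|M. iexp (u * X x))"
        unfolding char by (simp add: char_std_normal_distribution)
      also have "\<dots> = char (distr M borel X) u"
        unfolding char_def by (subst integral_distr) auto
      finally show "char (distr M borel X) u = char (distr std_normal_distribution borel (\<lambda>z. \<sigma> * z)) u" ..
    qed
  qed (auto intro!: real_distribution_distr N.real_distribution_distr)
  moreover have "AE z in distr std_normal_distribution borel (\<lambda>z. \<sigma> * z). z \<noteq> 0"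
  proof (subst AE_distr_iff)
    show "AE z in std_normal_distribution. \<sigma> * z \<noteq> 0"
      using AE_lborel_singleton[of 0] \<open>0 < \<sigma>\<close> by (subst AE_density) auto
  qed auto
  ultimately have "AE z in distr M borel X. z \<noteq> 0" by (simp only:)
  then show ?thesis by (subst (asm) AE_distr_iff) auto
qed

text \<open>If \<open>W2\<close> vanished almost surely, the second row of the matrix would vanish. When the matrix-valued function is not
integrable, its Bochner integral has the default value 0 and is not invertible either.\<close>

lemma second_moment_pos_if_invertible:
  assumes "invertible (second_moment_matrix M (\<lambda>x. vector [W1 x, W2 x]))"
    and int: "integrable M (\<lambda>x. (cmod (W2 x))\<^sup>2)"
  shows "0 < (LINT x|M. (cmod (W2 x))\<^sup>2)"
proof (rule ccontr)
  assume "\<not> ?thesis"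
  moreover have "0 \<le> (LINT x|M. (cmod (W2 x))\<^sup>2)" by simp
  ultimately have "(LINT x|M. (cmod (W2 x))\<^sup>2) = 0" by linarith
  then have W2: "AE x in M. W2 x = 0"
    using int by (subst (asm) integral_nonneg_eq_0_iff_AE) auto
  let ?A = "\<lambda>x. (columnvector (vector [W1 x, W2 x] :: complex^2) :: complex^1^2)
     ** conj_transpose (columnvector (vector [W1 x, W2 x] :: complex^2))"
  have A: "?A x $ 2 $ j = W2 x * cnj (vector [W1 x, W2 x] $ j)" for x j
    by (simp add: matrix_matrix_mult_def conj_transpose_def columnvector_def)
  have row: "second_moment_matrix M (\<lambda>x. vector [W1 x, W2 x]) $ 2 $ j = 0" for j
  proof (cases "integrable M ?A")
    case True
    have "bounded_linear (\<lambda>B :: complex^2^2. B $ 2 $ j)"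
      using bounded_linear_compose[OF bounded_linear_vec_nth[of j] bounded_linear_vec_nth[of 2]] by simp
    from integral_bounded_linear[OF this True]
    have "second_moment_matrix M (\<lambda>x. vector [W1 x, W2 x]) $ 2 $ j = (CLINT x|M. ?A x $ 2 $ j)"
      by (simp add: second_moment_matrix_def)
    also have "\<dots> = 0" unfolding A using W2 by (intro integral_eq_zero_AE) auto
    finally show ?thesis .
  next
    case False
    then show ?thesis by (simp add: second_moment_matrix_def not_integrable_integral_eq)
  qed
  then have "det (second_moment_matrix M (\<lambda>x. vector [W1 x, W2 x])) = 0" by (simp add: det_2)
  then show False using assms(1) by (simp add: invertible_det_nz)
qed

theorem corollary7:
  fixes M :: "'a measure"
    and \<Phi> :: "real \<Rightarrow> 'a \<Rightarrow> real"
    and C :: "real \<Rightarrow> real"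
    and F :: "real measure"
    and \<psi> :: "real \<Rightarrow> complex"
    and t1 t2 s1 s2 :: real
  assumes "prob_space M"
    and "analytic_mother_wavelet \<psi>"
    and "jointly_measurable M \<Phi>"
    and "gaussian_process M \<Phi>"
    and "stationary_with_covariance M \<Phi> C"
    and "spectral_measure_of F C"
    and "s1 > 0" and "s2 > 0"
    and "(t1, s1) \<noteq> (t2, s2)"
    and "invertible (second_moment_matrix M
           (\<lambda>x. vector [wavelet_transform \<psi> \<Phi> t1 s1 x, wavelet_transform \<psi> \<Phi> t2 s2 x]))"
  shows "prob_space.indep_var M
           borel (\<lambda>x. cmod (wavelet_transform \<psi> \<Phi> t1 s1 x))
           borel (\<lambda>x. wavelet_phase \<psi> \<Phi> t2 s2 x)"
proof -
  interpret prob_space M by fact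
  have "gaussian_rv M (\<Phi> t)" for t
    using assms(4)[unfolded gaussian_process_def, rule_format, of "{t}" "\<lambda>_. 1"] by simp
  note \<Phi> = gaussian_rv_moments[OF this]
  obtain \<mu> where \<mu>: "\<And>t. expectation (\<Phi> t) = \<mu>" and cov: "\<And>s t. covariance M (\<Phi> s) (\<Phi> t) = C (s - t)"
    using assms(5) unfolding stationary_with_covariance_def by blast
  interpret bounded_second_order_process M \<Phi> "C 0 + \<mu>\<^sup>2"
  proof
    show "case_prod \<Phi> \<in> borel_measurable (borel \<Otimes>\<^sub>M M)"
      using assms(3) by (simp add: jointly_measurable_def)
    fix t
    show "integrable M (\<lambda>x. (\<Phi> t x)\<^sup>2)" by (rule \<Phi>)
    have "integrable M (\<Phi> t)" by (rule square_integrable_imp_integrable[OF \<Phi>(1) \<Phi>(2)])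
    from variance_eq[OF this \<Phi>(2)]
    have "variance (\<Phi> t) = expectation (\<lambda>x. (\<Phi> t x)\<^sup>2) - \<mu>\<^sup>2"
      by (simp add: \<mu>)
    moreover have "variance (\<Phi> t) = C 0"
      using cov[of t t] by (simp add: covariance_def power2_eq_square)
    ultimately show "expectation (\<lambda>x. (\<Phi> t x)\<^sup>2) \<le> C 0 + \<mu>\<^sup>2" by simp
  qed
  define g1 where "g1 = wavelet_atom \<psi> t1 s1"
  define g2 where "g2 = wavelet_atom \<psi> t2 s2"
  have \<psi>: "integrable lborel \<psi>" and an: "\<And>w. w \<le> 0 \<Longrightarrow> fourier \<psi> w = 0"
    using assms(2) by (auto simp: analytic_mother_wavelet_def)
  have ig: "integrable lborel g1" "integrable lborel g2"
    unfolding g1_def g2_def using \<psi> assms(7,8) by (auto intro: integrable_wavelet_atom)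
  have van: "(CLINT \<tau>|lborel. g1 \<tau> * iexp (l * \<tau>)) = 0" "(CLINT \<tau>|lborel. g2 \<tau> * iexp (l * \<tau>)) = 0"
    if "l \<le> 0" for l
    unfolding g1_def g2_def fourier_wavelet_atom[OF assms(7)] fourier_wavelet_atom[OF assms(8)]
    using that assms(7,8) by (simp_all add: an mult_nonneg_nonpos)
  define W1 where "W1 = path_integral g1"
  define W2 where "W2 = path_integral g2"
  have W: "wavelet_transform \<psi> \<Phi> t1 s1 = W1" "wavelet_transform \<psi> \<Phi> t2 s2 = W2"
    by (auto simp: W1_def W2_def g1_def g2_def wavelet_transform_def path_integral_def wavelet_atom_def mult.assoc)
  note [measurable] = borel_measurable_integrable[OF ig(1)] borel_measurable_integrable[OF ig(2)]
  have [measurable]: "W1 \<in> borel_measurable M" "W2 \<in> borel_measurable M"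
    unfolding W1_def W2_def by measurable
  \<comment> \<open>The transform is linear in the atom, so the combination \<open>a * W1 + b * W2\<close> is almost surely a single path
    integral, of \<open>a * g1 + b * g2\<close>; almost surely only, because both integrals have to converge.\<close>
  have char: "expectation (\<lambda>x. iexp (Re (a * W1 x + b * W2 x)))
      = exp (- of_real (expectation (\<lambda>x. (cmod (a * W1 x + b * W2 x))\<^sup>2)) / 4)" for a b
  proof -
    define k where "k t = a * g1 t + b * g2 t" for t
    have k: "integrable lborel k" unfolding k_def using ig by simp
    note [measurable] = borel_measurable_integrable[OF k]
    have vk: "(CLINT \<tau>|lborel. k \<tau> * iexp (l * \<tau>)) = 0" if "l \<le> 0" for l
    proof -
      have i: "integrable lborel (\<lambda>\<tau>. g \<tau> * iexp (l * \<tau>))" if "integrable lborel g" for g :: "real \<Rightarrow> complex"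
        using that borel_measurable_integrable[OF that]
        by (intro Bochner_Integration.integrable_bound[OF that]) (auto simp: norm_mult)
      have "(CLINT \<tau>|lborel. k \<tau> * iexp (l * \<tau>)) = (CLINT \<tau>|lborel. a * (g1 \<tau> * iexp (l * \<tau>)) + b * (g2 \<tau> * iexp (l * \<tau>)))"
        by (simp add: k_def algebra_simps)
      also have "\<dots> = a * (CLINT \<tau>|lborel. g1 \<tau> * iexp (l * \<tau>)) + b * (CLINT \<tau>|lborel. g2 \<tau> * iexp (l * \<tau>))"
        using i[OF ig(1)] i[OF ig(2)] by (simp add: Bochner_Integration.integral_add)
      finally show ?thesis using van[OF that] by simp
    qed
    have ae: "AE x in M. path_integral k x = a * W1 x + b * W2 x"
      using AE_integrable_path[OF ig(1)] AE_integrable_path[OF ig(2)]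
    proof eventually_elim
      fix x assume i: "integrable lborel (\<lambda>t. of_real (\<Phi> t x) * g1 t)" "integrable lborel (\<lambda>t. of_real (\<Phi> t x) * g2 t)"
      have "path_integral k x = (CLINT t|lborel. a * (of_real (\<Phi> t x) * g1 t) + b * (of_real (\<Phi> t x) * g2 t))"
        by (simp add: path_integral_def k_def algebra_simps)
      also have "\<dots> = a * W1 x + b * W2 x"
        using i by (simp add: W1_def W2_def path_integral_def)
      finally show "path_integral k x = a * W1 x + b * W2 x" .
    qed
    have "expectation (\<lambda>x. iexp (Re (a * W1 x + b * W2 x))) = expectation (\<lambda>x. iexp (Re (path_integral k x)))"
      using ae by (intro integral_cong_AE) auto
    moreover have "expectation (\<lambda>x. (cmod (a * W1 x + b * W2 x))\<^sup>2) = expectation (\<lambda>x. (cmod (path_integral k x))\<^sup>2)"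
      using ae by (intro integral_cong_AE) auto
    ultimately show ?thesis
      using char_Re_analytic_path_integral[OF k assms(4-6) vk] by simp
  qed
  \<comment> \<open>Inner products with \<open>(a, b)\<close> are real parts of \<open>cnj a * W1 + cnj b * W2\<close>, and a common unit factor
    does not change the modulus in \<open>char\<close>.\<close>
  have inv: "distr M borel (\<lambda>x. (c * W1 x, c * W2 x)) = distr M borel (\<lambda>x. (W1 x, W2 x))"
    if c: "cmod c = 1" for c
  proof (rule Levy_uniqueness_euclidean)
    have [measurable]: "(\<lambda>x. (c * W1 x, c * W2 x)) \<in> borel_measurable M" "(\<lambda>x. (W1 x, W2 x)) \<in> borel_measurable M"
      unfolding borel_prod[symmetric] by measurable
    show "prob_space (distr M borel (\<lambda>x. (c * W1 x, c * W2 x)))" "prob_space (distr M borel (\<lambda>x. (W1 x, W2 x)))"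
      by (auto intro!: prob_space_distr)
    fix t :: "complex \<times> complex"
    obtain a b where t: "t = (a, b)" by (cases t)
    have inn: "(z, w) \<bullet> t = Re (cnj a * z + cnj b * w)" for z w
      by (simp add: t inner_complex_def)
    have rot: "cnj a * (c * z) + cnj b * (c * w) = c * (cnj a * z + cnj b * w)" for z w
      by (simp add: algebra_simps)
    have "(CLINT z|distr M borel (\<lambda>x. (c * W1 x, c * W2 x)). iexp (z \<bullet> t))
        = expectation (\<lambda>x. iexp (Re ((cnj a * c) * W1 x + (cnj b * c) * W2 x)))"
      by (subst integral_distr) (auto simp: inn mult.assoc)
    also have "\<dots> = expectation (\<lambda>x. iexp (Re (cnj a * W1 x + cnj b * W2 x)))"
      unfolding char using c by (simp add: mult.assoc rot norm_mult)
    also have "\<dots> = (CLINT z|distr M borel (\<lambda>x. (W1 x, W2 x)). iexp (z \<bullet> t))"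
      by (subst integral_distr) (auto simp: inn)
    finally show "(CLINT z|distr M borel (\<lambda>x. (c * W1 x, c * W2 x)). iexp (z \<bullet> t))
        = (CLINT z|distr M borel (\<lambda>x. (W1 x, W2 x)). iexp (z \<bullet> t))" .
  qed auto
  have pos: "0 < expectation (\<lambda>x. (cmod (W2 x))\<^sup>2)"
    using assms(10) square_integrable_path_integral[OF ig(2)]
    unfolding W W2_def[symmetric] by (rule second_moment_pos_if_invertible)
  have "AE x in M. Re (W2 x) \<noteq> 0"
  proof (rule AE_nonzero_if_normal_char)
    let ?s = "sqrt (expectation (\<lambda>x. (cmod (W2 x))\<^sup>2) / 2)"
    show "0 < ?s" using pos by simp
    fix u
    show "expectation (\<lambda>x. iexp (u * Re (W2 x))) = of_real (exp (- (u * ?s)\<^sup>2 / 2))"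
      using char[of 0 "of_real u"] pos
      by (simp add: norm_mult power_mult_distrib flip: exp_of_real)
  qed (use prob_space_axioms in auto)
  then have "AE x in M. W2 x \<noteq> 0" by eventually_elim auto
  then show ?thesis
    unfolding wavelet_phase_def W
    by (intro indep_cmod_Arg2pi_if_rotation_invariant inv) auto
qed

end
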